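(* Let $M$, $m$, and $N$ be positive integers. For any $m\times m$ block matrix function $F(z)$ (with blocks of size $M\times M$) of the form $$ F(z)=\begin{pmatrix}I_M&0_M&\cdots&0_M&0_M\\ 0_M&I_M&\cdots&0_M&0_M\\ \vdots&\vdots&\ddots&\vdots&\vdots\\ 0_M&0_M&\cdots&I_M&0_M\\ \zeta_{1}(z)&\zeta_{2}(z)&\cdots&\zeta_{m-1}(z)&f(z) \end{pmatrix}, $$ where $\zeta_j\in \mathcal{P}_N^-(M)$ for $j=1,2,\ldots,m-1$, and $f\in\mathcal{P}_N^+(M)$ with $\det C_0\{f\}\neq 0$, there exists a para-unitary matrix function $U$ of the form $$ U(z)=\begin{pmatrix}u_{11}(z)&u_{12}(z)&\cdots&u_{1m}(z)\\ \vdots&\vdots&\ddots&\vdots\\ u_{m-1,1}(z)&u_{m-1,2}(z)&\cdots&u_{m-1,m}(z)\\ \widetilde{u_{m1}}(z)&\widetilde{u_{m2}}(z)&\cdots&\widetilde{u_{mm}}(z) \end{pmatrix}, $$ where $u_{ij}\in \mathcal{P}_N^+(M)$ for $i,j=1,2,\ldots,m$, with $\det U(z)=1$ for each $z\in\mathbb{C}\setminus\{0\}$, such that $$ F U\in \big(\mathcal{P}_N^+(M)\big)^{m\times m}. $$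
   Context: $I_M$ and $0_M$ denote the $M\times M$ identity and zero matrices. For $n_1,n_2\in\{0,1,2,\dots\}$, $\mathcal{P}_{\{-n_1,n_2\}}(M)$ is the set of Laurent matrix polynomials $\sum_{n=-n_1}^{n_2}A_nz^n$ with $A_n\in\mathbb{C}^{M\times M}$. Put $\mathcal{P}^+_N(M)=\mathcal{P}_{\{0,N\}}(M)$ and $\mathcal{P}^-_N(M)=\mathcal{P}_{\{-N,0\}}(M)$. For a Laurent matrix polynomial $P(z)=\sum_{n} A_nz^n$, $C_n\{P\}=A_n$ denotes its $n$-th (matrix) Fourier coefficient, and its adjoint is $\widetilde{P}(z)=\sum_{n}A_n^Hz^{-n}$, where $A^H$ is the Hermitian conjugate of $A$. The notation $\big(\mathcal{P}_N^+(M)\big)^{m\times m}$ means the set of $m\times m$ block matrices whose blocks belong to $\mathcal{P}_N^+(M)$ (so these are $mM\times mM$ matrix functions). A square Laurent matrix polynomial $U$ of size $K\times K$ is called para-unitary if $U(z)\widetilde{U}(z)=\widetilde{U}(z)U(z)=I_K$ for each $z\in\mathbb{C}\setminus\{0\}$; here $K=mM$. *)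

theory Defs
  imports Complex_Main "Jordan_Normal_Form.Schur_Decomposition"
begin

text \<open>A matrix-valued Laurent polynomial is represented by its bi-infinite sequence of
  coefficients, so that \<open>P n\<close> is the \<open>n\<close>-th Fourier coefficient \<open>C\<^sub>n{P}\<close>. The associated
  matrix function on the punctured plane is \<open>laurent_eval\<close>. All indices
  of matrices and of blocks start at 0.\<close>

type_synonym laurent_mat = "int \<Rightarrow> complex mat"

definition laurent_polys :: "nat \<Rightarrow> nat \<Rightarrow> nat \<Rightarrow> laurent_mat set" where
  "laurent_polys n1 n2 K =
     {P. (\<forall>n. P n \<in> carrier_mat K K) \<and> (\<forall>n. n < - int n1 \<or> int n2 < n \<longrightarrow> P n = 0\<^sub>m K K)}"

definition polys_plus :: "nat \<Rightarrow> nat \<Rightarrow> laurent_mat set" where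
  "polys_plus N K = laurent_polys 0 N K"

definition polys_minus :: "nat \<Rightarrow> nat \<Rightarrow> laurent_mat set" where
  "polys_minus N K = laurent_polys N 0 K"

definition laurent_const :: "complex mat \<Rightarrow> laurent_mat" where
  "laurent_const A n = (if n = 0 then A else 0\<^sub>m (dim_row A) (dim_col A))"

definition laurent_adj :: "laurent_mat \<Rightarrow> laurent_mat" where
  "laurent_adj P n = mat_adjoint (P (- n))"

text \<open>The type of matrices of all sizes has no neutral element for addition, so the sum of the
  matrices \<open>z powi n \<cdot>\<^sub>m P n\<close> is formed entrywise. It is finite for Laurent polynomials.\<close>

definition laurent_eval :: "nat \<Rightarrow> laurent_mat \<Rightarrow> complex \<Rightarrow> complex mat" where
  "laurent_eval K P z = mat K K (\<lambda>(i, j). \<Sum>n | P n \<noteq> 0\<^sub>m K K. P n $$ (i, j) * z powi n)"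

lemma laurent_eval_altdef:
  assumes "P \<in> laurent_polys n1 n2 K"
  shows "laurent_eval K P z =
    mat K K (\<lambda>(i, j). \<Sum>n = - int n1..int n2. P n $$ (i, j) * z powi n)"
proof -
  have sub: "{n. P n \<noteq> 0\<^sub>m K K} \<subseteq> {- int n1..int n2}"
  proof
    fix n
    assume "n \<in> {n. P n \<noteq> 0\<^sub>m K K}"
    then have "\<not> (n < - int n1 \<or> int n2 < n)"
      using assms unfolding laurent_polys_def by blast
    then show "n \<in> {- int n1..int n2}" by simp
  qed
  have "(\<Sum>n | P n \<noteq> 0\<^sub>m K K. P n $$ (i, j) * z powi n) =
      (\<Sum>n = - int n1..int n2. P n $$ (i, j) * z powi n)" if "i < K" "j < K" for i j
  proof (rule sum.mono_neutral_left[OF _ sub])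
    show "\<forall>n \<in> {- int n1..int n2} - {n. P n \<noteq> 0\<^sub>m K K}. P n $$ (i, j) * z powi n = 0"
      using that by simp
  qed simp
  then show ?thesis
    unfolding laurent_eval_def by (intro cong_mat) auto
qed

definition para_unitary :: "nat \<Rightarrow> laurent_mat \<Rightarrow> bool" where
  "para_unitary K U \<longleftrightarrow> (\<exists>n1 n2. U \<in> laurent_polys n1 n2 K) \<and>
     (\<forall>z. z \<noteq> 0 \<longrightarrow>
        laurent_eval K U z * laurent_eval K (laurent_adj U) z = 1\<^sub>m K \<and>
        laurent_eval K (laurent_adj U) z * laurent_eval K U z = 1\<^sub>m K)"

text \<open>The \<open>m \<times> m\<close> block matrix with the \<open>M \<times> M\<close> blocks \<open>B i j\<close>, \<open>i, j < m\<close>.\<close>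

definition block_laurent ::
  "nat \<Rightarrow> nat \<Rightarrow> (nat \<Rightarrow> nat \<Rightarrow> laurent_mat) \<Rightarrow> laurent_mat" where
  "block_laurent m M B n =
     mat (m * M) (m * M) (\<lambda>(a, b). B (a div M) (b div M) n $$ (a mod M, b mod M))"

definition block_set :: "nat \<Rightarrow> nat \<Rightarrow> laurent_mat set \<Rightarrow> laurent_mat set" where
  "block_set m M S = {block_laurent m M B | B. \<forall>i<m. \<forall>j<m. B i j \<in> S}"

end

theory Submission
  imports Defs
begin

text \<open>
  Put \<open>L = (m - 1) M\<close> and \<open>K = m M\<close>, and write \<open>F = (1, 0; \<zeta>, f)\<close> with diagonal blocks of
  sizes \<open>L\<close> and \<open>M\<close>; write \<open>P\<^sup>+\<close> and \<open>P\<^sup>-\<close> for the polynomials in \<open>z\<close> and in \<open>1/z\<close>, and a tilde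
  for the adjoint.

  The entry \<open>f\<close> can be removed. Because \<open>f(0)\<close> is invertible, there is an \<open>M \<times> L\<close> matrix \<open>w\<close> of
  polynomials of degree at most \<open>N\<close> in \<open>1/z\<close> with \<open>\<zeta> + f w\<close> in \<open>P\<^sup>+\<close> (lemma
  \<open>negative_part_absorbed\<close>). The last block row of \<open>F\<close> maps a column \<open>(x, y)\<close> with \<open>x\<close> in \<open>P\<^sup>+\<close> to
  \<open>\<zeta> x + f y = (\<zeta> + f w) x + f (y - w x)\<close>, so it is enough that \<open>y - w x\<close> is in \<open>P\<^sup>+\<close>, that is,
  that \<open>\<Phi> = (1, 0; -w, 1)\<close> maps the column into \<open>P\<^sup>+\<close>.

  The adjoint inverse of \<open>\<Phi>\<close> is \<open>\<Psi> = (1, w~; 0, 1)\<close>. The columns of \<open>U\<close> are chosen among the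
  \<open>(x, y)\<close> with \<open>x\<close> in \<open>P\<^sup>+\<close> and \<open>y\<close> in \<open>P\<^sup>-\<close>, of degree at most \<open>N\<close>, for which \<open>\<Phi> (x, y)\<close> is in
  \<open>P\<^sup>+\<close> and, in addition, \<open>\<Psi> (x, y)\<close> is in \<open>P\<^sup>-\<close>. This second condition is what makes \<open>U\<close>
  unitary: if all columns of \<open>U\<close> satisfy both, then \<open>U~ U = (\<Psi> U)~ (\<Phi> U)\<close> lies in \<open>P\<^sup>+\<close>; being
  self-adjoint it lies in \<open>P\<^sup>-\<close> as well, so it is constant (lemma \<open>pairing_constant\<close>). Similarly
  \<open>det U = det (\<Phi> U)\<close> is in \<open>P\<^sup>+\<close> and \<open>det U = det (\<Psi> U)\<close> is in \<open>P\<^sup>-\<close>, so \<open>det U\<close> is constant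
  (lemma \<open>det_loop_mat_constant\<close>).

  It remains to find \<open>K\<close> columns with \<open>U~ U = 1\<close> at the single point \<open>z = 1\<close>. The two conditions are
  \<open>K N\<close> homogeneous linear equations for the \<open>K (N + 1)\<close> coefficients of a column. With \<open>k < K\<close>
  columns already found, orthogonality to them at \<open>z = 1\<close> costs only \<open>k\<close> more equations, so there
  is always a further nonzero column, which can be normalised (lemma \<open>orthonormal_solutions\<close>).
  Finally the constant \<open>det U\<close> has modulus 1, and rescaling one column by its conjugate makes it 1.
\<close>

section \<open>Functions that are polynomials on the punctured plane\<close>

text \<open>The functions of class \<open>P\<^sup>+\<close>. The value at 0 is left out because Laurent polynomials only have
  meaning away from 0; membership of \<open>g\<close> in \<open>P\<^sup>-\<close> is expressed as \<open>polyfun (\<lambda>z. g (1 / z))\<close>.\<close>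

definition polyfun :: "(complex \<Rightarrow> complex) \<Rightarrow> bool" where
  "polyfun g \<longleftrightarrow> (\<exists>p. \<forall>z. z \<noteq> 0 \<longrightarrow> g z = poly p z)"

lemma polyfunI: "(\<And>z. z \<noteq> 0 \<Longrightarrow> g z = poly p z) \<Longrightarrow> polyfun g"
  unfolding polyfun_def by blast

lemma polyfunE:
  assumes "polyfun g"
  obtains p where "\<And>z. z \<noteq> 0 \<Longrightarrow> g z = poly p z"
  using assms unfolding polyfun_def by blast

lemma polyfun_cong: "(\<And>z. z \<noteq> 0 \<Longrightarrow> g z = h z) \<Longrightarrow> polyfun g \<longleftrightarrow> polyfun h"
  unfolding polyfun_def by simp

lemma polyfun_poly: "polyfun (poly p)"
  by (rule polyfunI) simp

lemma polyfun_const: "polyfun (\<lambda>z. c)"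
  by (rule polyfunI[of _ "[:c:]"]) simp

lemma polyfun_add: "polyfun g \<Longrightarrow> polyfun h \<Longrightarrow> polyfun (\<lambda>z. g z + h z)"
  unfolding polyfun_def by (metis poly_add)

lemma polyfun_mult: "polyfun g \<Longrightarrow> polyfun h \<Longrightarrow> polyfun (\<lambda>z. g z * h z)"
  unfolding polyfun_def by (metis poly_mult)

lemma polyfun_sum: "(\<And>i. i \<in> A \<Longrightarrow> polyfun (g i)) \<Longrightarrow> polyfun (\<lambda>z. \<Sum>i\<in>A. g i z)"
  by (induction A rule: infinite_finite_induct) (auto intro: polyfun_add polyfun_const)

lemma polyfun_prod: "(\<And>i. i \<in> A \<Longrightarrow> polyfun (g i)) \<Longrightarrow> polyfun (\<lambda>z. \<Prod>i\<in>A. g i z)"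
  by (induction A rule: infinite_finite_induct) (auto intro: polyfun_mult polyfun_const)

lemma polyfun_cnj: "polyfun g \<Longrightarrow> polyfun (\<lambda>z. cnj (g (cnj z)))"
  unfolding polyfun_def by (metis complex_cnj_zero_iff poly_map_poly_cnj)

lemma polyfun_det:
  assumes "\<And>a b. a < n \<Longrightarrow> b < n \<Longrightarrow> polyfun (\<lambda>z. A z $$ (a, b))"
    and "\<And>z. A z \<in> carrier_mat n n"
  shows "polyfun (\<lambda>z. det (A z))"
proof -
  have "polyfun (\<lambda>z. \<Sum>p\<in>{p. p permutes {0..<n}}. signof p * (\<Prod>i = 0..<n. A z $$ (i, p i)))"
    using assms(1)
    by (intro polyfun_sum polyfun_mult polyfun_const polyfun_prod) (auto dest: permutes_in_image)
  then show ?thesis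
    using assms(2) by (simp add: det_def'[where n = n])
qed

lemma poly_eqI_punctured:
  fixes p q :: "complex poly"
  assumes "\<And>z. z \<noteq> 0 \<Longrightarrow> poly p z = poly q z"
  shows "p = q"
proof -
  have "poly (monom 1 1 * p) = poly (monom 1 1 * q)"
    using assms by (auto simp: fun_eq_iff poly_monom)
  then have "monom 1 1 * p = monom 1 1 * q"
    by (simp only: poly_eq_poly_eq_iff)
  then show ?thesis
    by simp
qed

text \<open>The function \<open>z\<^sup>N p(1/z)\<close> has lowest exponent \<open>N - degree p\<close>, which must not be negative. Used
  for two purposes: to bound the degree of \<open>F U\<close>, and with \<open>N = 0\<close> to recognise constants.\<close>

lemma polyfun_imp_degree_le:
  assumes "polyfun (\<lambda>z. z ^ N * poly p (1 / z))"
  shows "degree p \<le> N"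
proof (cases "p = 0")
  case False
  from assms obtain q where q: "\<And>z. z \<noteq> 0 \<Longrightarrow> z ^ N * poly p (1 / z) = poly q z"
    by (rule polyfunE) blast
  \<comment> \<open>After multiplication by \<open>z ^ degree p\<close> both sides are polynomials; the constant term of
    the reflected polynomial is the leading coefficient of \<open>p\<close>.\<close>
  have "monom 1 N * reflect_poly p = monom 1 (degree p) * q"
  proof (rule poly_eqI_punctured)
    fix z :: complex
    assume z: "z \<noteq> 0"
    have "poly (reflect_poly p) z = z ^ degree p * poly p (1 / z)"
      using z by (simp add: poly_reflect_poly_nz inverse_eq_divide)
    then show "poly (monom 1 N * reflect_poly p) z = poly (monom 1 (degree p) * q) z"
      using q[OF z] by (simp add: poly_monom)
  qed
  moreover have "coeff (monom 1 N * reflect_poly p) N \<noteq> 0"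
    using False by (simp add: coeff_monom_mult)
  ultimately show ?thesis
    by (metis coeff_monom_mult not_le)
qed simp

lemma polyfun_both_imp_constant:
  assumes "polyfun g" "polyfun (\<lambda>z. g (1 / z))"
  obtains c where "\<And>z. z \<noteq> 0 \<Longrightarrow> g z = c"
proof -
  from assms(1) obtain p where p: "\<And>z. z \<noteq> 0 \<Longrightarrow> g z = poly p z"
    by (rule polyfunE) blast
  have "polyfun (\<lambda>z. z ^ 0 * poly p (1 / z))"
    using assms(2) polyfun_cong[of "\<lambda>z. g (1 / z)" "\<lambda>z. z ^ 0 * poly p (1 / z)"] p by auto
  then have "degree p = 0"
    using polyfun_imp_degree_le by fastforce
  then obtain c where "p = [:c:]"
    by (rule degree_eq_zeroE)
  then show ?thesis
    using p that by auto
qed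

lemma poly_altdef_le:
  fixes p :: "'a::comm_semiring_1 poly"
  assumes "degree p \<le> N"
  shows "poly p x = (\<Sum>i\<le>N. coeff p i * x ^ i)"
  unfolding poly_altdef
  by (rule sum.mono_neutral_left) (use assms in \<open>auto simp: coeff_eq_0\<close>)

text \<open>The coefficient of \<open>1/z\<^sup>k\<close> in \<open>q(1/z) z\<^sup>i\<close> is the coefficient of index \<open>k + i\<close> in \<open>q\<close>: the
  conditions on solutions below therefore form a linear system of Hankel type.\<close>

lemma polyfun_minus_principal_part:
  assumes "degree q \<le> N"
  shows "polyfun (\<lambda>z. poly q (1 / z) * z ^ i - (\<Sum>k = 1..N. coeff q (k + i) * (1 / z) ^ k))"
proof (rule polyfunI[of _ "\<Sum>j\<le>i. monom (coeff q j) (i - j)"])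
  fix z :: complex
  assume z: "z \<noteq> 0"
  have "poly q (1 / z) = (\<Sum>j\<le>N + i. coeff q j * (1 / z) ^ j)"
    using assms by (intro poly_altdef_le) simp
  also have "{..N + i} = {..i} \<union> {1 + i..N + i}"
    by auto
  also have "(\<Sum>j\<in>\<dots>. coeff q j * (1 / z) ^ j) =
      (\<Sum>j\<le>i. coeff q j * (1 / z) ^ j) + (\<Sum>j = 1 + i..N + i. coeff q j * (1 / z) ^ j)"
    by (rule sum.union_disjoint) auto
  also have "(\<Sum>j = 1 + i..N + i. coeff q j * (1 / z) ^ j) =
      (\<Sum>k = 1..N. coeff q (k + i) * (1 / z) ^ (k + i))"
    by (rule sum.shift_bounds_cl_nat_ivl)
  finally have "poly q (1 / z) * z ^ i = (\<Sum>j\<le>i. coeff q j * (1 / z) ^ j * z ^ i)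
      + (\<Sum>k = 1..N. coeff q (k + i) * (1 / z) ^ (k + i) * z ^ i)"
    by (simp add: distrib_right sum_distrib_right)
  also have "(\<Sum>j\<le>i. coeff q j * (1 / z) ^ j * z ^ i) = (\<Sum>j\<le>i. coeff q j * z ^ (i - j))"
    using z by (intro sum.cong) (auto simp: power_diff power_divide)
  also have "(\<Sum>k = 1..N. coeff q (k + i) * (1 / z) ^ (k + i) * z ^ i) =
      (\<Sum>k = 1..N. coeff q (k + i) * (1 / z) ^ k)"
    using z by (intro sum.cong) (auto simp: power_add power_divide)
  finally show "poly q (1 / z) * z ^ i - (\<Sum>k = 1..N. coeff q (k + i) * (1 / z) ^ k) =
      poly (\<Sum>j\<le>i. monom (coeff q j) (i - j)) z"
    by (simp add: poly_sum poly_monom)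
qed

section \<open>Solutions of the coupled coefficient equations\<close>

lemma underdetermined_system:
  fixes A :: "'r \<Rightarrow> 'i \<Rightarrow> 'a::field"
  assumes "finite R" "finite I" "card R < card I"
  shows "\<exists>x. (\<exists>i\<in>I. x i \<noteq> 0) \<and> (\<forall>r\<in>R. (\<Sum>i\<in>I. A r i * x i) = 0)"
  using assms
proof (induction R arbitrary: I A rule: finite_induct)
  case empty
  then have "I \<noteq> {}"
    by auto
  then show ?case
    by (intro exI[of _ "\<lambda>_. 1"]) auto
next
  case (insert r R)
  show ?case
  proof (cases "\<exists>i0\<in>I. A r i0 \<noteq> 0")
    case False
    have "card R < card I"
      using insert.prems insert.hyps by simp
    then obtain x where "\<exists>i\<in>I. x i \<noteq> 0" "\<forall>s\<in>R. (\<Sum>i\<in>I. A s i * x i) = 0"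
      using insert.IH[OF insert.prems(1), of A] by blast
    moreover have "(\<Sum>i\<in>I. A r i * x i) = 0" for x
      using False by (intro sum.neutral) auto
    ultimately show ?thesis
      by blast
  next
    case True
    then obtain i0 where i0: "i0 \<in> I" "A r i0 \<noteq> 0"
      by blast
    \<comment> \<open>Gaussian elimination: row \<open>r\<close> is used to remove the unknown \<open>i0\<close> from the other rows.\<close>
    define B where "B s i = A s i - A s i0 * A r i / A r i0" for s i
    have "card R < card (I - {i0})"
      using insert.prems insert.hyps i0 by simp
    then obtain x where x: "\<exists>i\<in>I - {i0}. x i \<noteq> 0" "\<forall>s\<in>R. (\<Sum>i\<in>I - {i0}. B s i * x i) = 0"
      using insert.IH[of "I - {i0}" B] insert.prems(1) by blast
    define y where "y = x(i0 := - (\<Sum>i\<in>I - {i0}. A r i * x i) / A r i0)"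
    have split: "(\<Sum>i\<in>I. A s i * y i) = (\<Sum>i\<in>I - {i0}. B s i * x i)" for s
    proof -
      have "(\<Sum>i\<in>I. A s i * y i) = A s i0 * y i0 + (\<Sum>i\<in>I - {i0}. A s i * y i)"
        by (rule sum.remove[OF insert.prems(1) i0(1)])
      also have "(\<Sum>i\<in>I - {i0}. A s i * y i) = (\<Sum>i\<in>I - {i0}. A s i * x i)"
        by (intro sum.cong) (auto simp: y_def)
      also have "A s i0 * y i0 = - (\<Sum>i\<in>I - {i0}. A s i0 * A r i / A r i0 * x i)"
        by (simp add: y_def sum_distrib_left sum_divide_distrib mult_ac)
      finally show ?thesis
        by (simp add: B_def left_diff_distrib sum_subtractf)
    qed
    have "(\<Sum>i\<in>I. A s i * y i) = 0" if "s \<in> insert r R" for s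
    proof (cases "s = r")
      case True
      have "B r i = 0" for i
        using i0(2) by (simp add: B_def)
      with True show ?thesis
        by (simp add: split)
    next
      case False
      with that x(2) show ?thesis
        by (simp add: split)
    qed
    moreover have "\<exists>i\<in>I. y i \<noteq> 0"
      using x(1) by (auto simp: y_def)
    ultimately show ?thesis
      by blast
  qed
qed

text \<open>A Wiener--Hopf condition for each row. Row \<open>a\<close> is written in the variable in which its own polynomial \<open>p a\<close>
  has negative exponents. In the application \<open>T\<close> couples only upper with lower rows, and the
  conditions read \<open>\<Phi> (x, y) \<in> P\<^sup>+\<close> for the lower rows and \<open>\<Psi> (x, y) \<in> P\<^sup>-\<close> for the upper rows, the
  latter with \<open>1/z\<close> in place of \<open>z\<close>.\<close>

definition wh_solution :: "nat \<Rightarrow> nat \<Rightarrow> (nat \<Rightarrow> nat \<Rightarrow> complex poly) \<Rightarrow> (nat \<Rightarrow> complex poly) \<Rightarrow> bool" where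
  "wh_solution K N T p \<longleftrightarrow> (\<forall>a. degree (p a) \<le> N) \<and>
     (\<forall>a<K. polyfun (\<lambda>z. poly (p a) (1 / z) + (\<Sum>b<K. poly (T a b) (1 / z) * poly (p b) z)))"

text \<open>A count of unknowns: the \<open>K (N + 1)\<close> coefficients of a column satisfy the \<open>K N\<close> equations for
  the powers \<open>1/z, \<dots>, 1/z\<^sup>N\<close> in the \<open>K\<close> rows and, since \<open>k < K\<close>, there is room for \<open>k\<close> further linear
  conditions on the values at 1.\<close>

lemma wiener_hopf_system_solvable:
  fixes T :: "nat \<Rightarrow> nat \<Rightarrow> complex poly" and c :: "nat \<Rightarrow> nat \<Rightarrow> complex"
  assumes T: "\<And>a b. degree (T a b) \<le> N" and "k < K"
  obtains p :: "nat \<Rightarrow> complex poly" where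
    "wh_solution K N T p" "\<exists>a<K. p a \<noteq> 0"
    "\<And>r. r < k \<Longrightarrow> (\<Sum>a<K. c r a * poly (p a) 1) = 0"
proof -
  define R :: "(nat \<times> nat + nat) set" where "R = ({..<K} \<times> {1..N}) <+> {..<k}"
  define I :: "(nat \<times> nat) set" where "I = {..<K} \<times> {..N}"
  \<comment> \<open>\<open>Inl (a, j)\<close> is the coefficient of \<open>1/z\<^sup>j\<close> in row \<open>a\<close>, \<open>Inr s\<close> the \<open>s\<close>-th condition at 1.\<close>
  define A where "A r bi = (case bi of (b, i) \<Rightarrow> (case r of
      Inl (a, j) \<Rightarrow> (if b = a \<and> i = j then 1 else 0) + coeff (T a b) (j + i)
    | Inr s \<Rightarrow> c s b))" for r bi
  have "card R < card I"
    using \<open>k < K\<close> by (simp add: R_def I_def card_Plus)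
  then obtain x where x: "\<exists>bi\<in>I. x bi \<noteq> 0" "\<And>r. r \<in> R \<Longrightarrow> (\<Sum>bi\<in>I. A r bi * x bi) = 0"
    using underdetermined_system[of R I A] by (auto simp: R_def I_def)
  define p where "p b = (\<Sum>i\<le>N. monom (x (b, i)) i)" for b
  have coeff_p: "coeff (p b) i = x (b, i)" if "i \<le> N" for b i
    using that unfolding p_def by (simp add: coeff_sum_monom)
  have deg: "degree (p b) \<le> N" for b
    unfolding p_def by (rule degree_sum_le) (auto intro: degree_monom_le order_trans)
  have poly_p: "poly (p b) z = (\<Sum>i\<le>N. x (b, i) * z ^ i)" for b z
    by (simp add: p_def poly_sum poly_monom)
  have polyfun_p: "polyfun (\<lambda>z. poly (p a) (1 / z) + (\<Sum>b<K. poly (T a b) (1 / z) * poly (p b) z))"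
    if a: "a < K" for a
  proof -
    have eq: "x (a, j) + (\<Sum>b<K. \<Sum>i\<le>N. coeff (T a b) (j + i) * x (b, i)) = 0"
      if "1 \<le> j" "j \<le> N" for j
    proof -
      have "(\<Sum>bi\<in>I. A (Inl (a, j)) bi * x bi) = 0"
        using a that by (intro x(2)) (auto simp: R_def)
      also have "(\<Sum>bi\<in>I. A (Inl (a, j)) bi * x bi) =
          (\<Sum>bi\<in>I. (if bi = (a, j) then x bi else 0)) +
          (\<Sum>(b, i)\<in>I. coeff (T a b) (j + i) * x (b, i))"
        unfolding sum.distrib[symmetric]
        by (intro sum.cong) (auto simp: A_def distrib_right split: prod.splits)
      also have "(\<Sum>bi\<in>I. (if bi = (a, j) then x bi else 0)) = x (a, j)"
        using a that by (simp add: I_def)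
      finally show ?thesis
        by (simp add: I_def sum.cartesian_product)
    qed
    have "poly (p a) (1 / z) + (\<Sum>b<K. poly (T a b) (1 / z) * poly (p b) z) =
        x (a, 0) + (\<Sum>b<K. \<Sum>i\<le>N. x (b, i) *
          (poly (T a b) (1 / z) * z ^ i - (\<Sum>j = 1..N. coeff (T a b) (j + i) * (1 / z) ^ j)))"
      (is "_ = ?rhs z") for z
    proof -
      have "poly (p a) (1 / z) = x (a, 0) + (\<Sum>j = 1..N. x (a, j) * (1 / z) ^ j)"
        unfolding poly_p atMost_atLeast0 by (subst sum.atLeast_Suc_atMost) auto
      also have "(\<Sum>j = 1..N. x (a, j) * (1 / z) ^ j) =
          (\<Sum>j = 1..N. - (\<Sum>b<K. \<Sum>i\<le>N. coeff (T a b) (j + i) * x (b, i)) * (1 / z) ^ j)"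
        using eq by (intro sum.cong refl arg_cong2[of _ _ _ _ "(*)"]) (auto simp: eq_neg_iff_add_eq_0)
      also have "\<dots> = - (\<Sum>b<K. \<Sum>i\<le>N. x (b, i) * (\<Sum>j = 1..N. coeff (T a b) (j + i) * (1 / z) ^ j))"
      proof -
        have "(\<Sum>j = 1..N. \<Sum>b<K. \<Sum>i\<le>N. x (b, i) * (coeff (T a b) (j + i) * (1 / z) ^ j)) =
            (\<Sum>b<K. \<Sum>j = 1..N. \<Sum>i\<le>N. x (b, i) * (coeff (T a b) (j + i) * (1 / z) ^ j))"
          by (rule sum.swap)
        also have "\<dots> = (\<Sum>b<K. \<Sum>i\<le>N. \<Sum>j = 1..N. x (b, i) * (coeff (T a b) (j + i) * (1 / z) ^ j))"
          by (intro sum.cong refl sum.swap)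
        finally show ?thesis
          by (simp add: sum_distrib_left sum_distrib_right sum_negf mult_ac)
      qed
      finally show ?thesis
        by (simp add: poly_p sum_distrib_left right_diff_distrib sum_subtractf mult_ac)
    qed
    moreover have "polyfun ?rhs"
      by (intro polyfun_add polyfun_const polyfun_sum polyfun_mult polyfun_minus_principal_part T)
    ultimately show ?thesis
      by simp
  qed
  show ?thesis
  proof
    show "wh_solution K N T p"
      using deg polyfun_p by (simp add: wh_solution_def)
    from x(1) obtain b i where "b < K" "i \<le> N" "x (b, i) \<noteq> 0"
      by (auto simp: I_def)
    then show "\<exists>a<K. p a \<noteq> 0"
      using coeff_p[of i b] by (metis coeff_0)
  next
    fix s
    assume "s < k"
    then have "(\<Sum>bi\<in>I. A (Inr s) bi * x bi) = 0"
      by (intro x(2)) (auto simp: R_def)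
    then show "(\<Sum>a<K. c s a * poly (p a) 1) = 0"
      by (simp add: A_def I_def poly_p sum.cartesian_product sum_distrib_left case_prod_unfold)
  qed
qed

section \<open>Pairing of solutions\<close>

text \<open>This is the scalar form of \<open>U~ U = (\<Psi> U)~ (\<Phi> U)\<close>. Multiplying the row functions \<open>E\<close> of \<open>p\<close> by
  the conjugates of \<open>q\<close>, and the conjugates of the row functions \<open>H\<close> of \<open>q\<close> by \<open>p\<close>, gives
  products of polynomials; in their sum the coupling terms cancel because \<open>T\<close> is skew-Hermitian.
  Either of the two groups of rows may play the role of \<open>A\<close>.\<close>

lemma coupled_solutions_pairing_polyfun:
  assumes p: "\<And>a. a \<in> A \<Longrightarrow>
      polyfun (\<lambda>z. poly (p a) (1 / z) + (\<Sum>b\<in>B. poly (T a b) (1 / z) * poly (p b) z))"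
    and q: "\<And>b. b \<in> B \<Longrightarrow>
      polyfun (\<lambda>z. poly (q b) (1 / z) + (\<Sum>a\<in>A. poly (T b a) (1 / z) * poly (q a) z))"
    and skew: "\<And>a b. a \<in> A \<Longrightarrow> b \<in> B \<Longrightarrow> T b a = - map_poly cnj (T a b)"
  shows "polyfun (\<lambda>z. (\<Sum>a\<in>A. cnj (poly (q a) (cnj z)) * poly (p a) (1 / z)) +
    (\<Sum>b\<in>B. cnj (poly (q b) (1 / cnj z)) * poly (p b) z))" (is "polyfun ?g")
proof -
  define E where "E a z = poly (p a) (1 / z) + (\<Sum>b\<in>B. poly (T a b) (1 / z) * poly (p b) z)" for a z
  define H where "H b z = poly (q b) (1 / z) + (\<Sum>a\<in>A. poly (T b a) (1 / z) * poly (q a) z)" for b z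
  have "?g z = (\<Sum>a\<in>A. poly (map_poly cnj (q a)) z * E a z) +
      (\<Sum>b\<in>B. cnj (H b (cnj z)) * poly (p b) z)" for z
  proof -
    have "(\<Sum>b\<in>B. cnj (H b (cnj z)) * poly (p b) z) =
        (\<Sum>b\<in>B. cnj (poly (q b) (1 / cnj z)) * poly (p b) z) -
        (\<Sum>b\<in>B. \<Sum>a\<in>A. cnj (poly (q a) (cnj z)) * (poly (T a b) (1 / z) * poly (p b) z))"
      unfolding sum_subtractf[symmetric]
      by (intro sum.cong refl)
         (simp add: H_def skew left_diff_distrib right_diff_distrib sum_distrib_left sum_distrib_right
            sum_negf mult_ac)
    moreover have "(\<Sum>a\<in>A. poly (map_poly cnj (q a)) z * E a z) =
        (\<Sum>a\<in>A. cnj (poly (q a) (cnj z)) * poly (p a) (1 / z)) +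
        (\<Sum>a\<in>A. \<Sum>b\<in>B. cnj (poly (q a) (cnj z)) * (poly (T a b) (1 / z) * poly (p b) z))"
      by (simp add: E_def distrib_left sum.distrib sum_distrib_left)
    moreover have "(\<Sum>a\<in>A. \<Sum>b\<in>B. cnj (poly (q a) (cnj z)) * (poly (T a b) (1 / z) * poly (p b) z)) =
        (\<Sum>b\<in>B. \<Sum>a\<in>A. cnj (poly (q a) (cnj z)) * (poly (T a b) (1 / z) * poly (p b) z))"
      by (rule sum.swap)
    ultimately show ?thesis
      by simp
  qed
  moreover have "polyfun (\<lambda>z. (\<Sum>a\<in>A. poly (map_poly cnj (q a)) z * E a z) +
      (\<Sum>b\<in>B. cnj (H b (cnj z)) * poly (p b) z))"
    using p q unfolding E_def[symmetric] H_def[symmetric]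
    by (intro polyfun_add polyfun_sum polyfun_mult polyfun_poly polyfun_cnj)
  ultimately show ?thesis
    by (simp only:)
qed

lemma infinite_unit_circle: "infinite {z :: complex. cmod z = 1}"
proof -
  have "inj_on (\<lambda>t. Complex t (sqrt (1 - t\<^sup>2))) {0<..<1}"
    by (rule inj_onI) simp
  then have "infinite ((\<lambda>t. Complex t (sqrt (1 - t\<^sup>2))) ` {0<..<1::real})"
    by (simp add: finite_image_iff)
  moreover have "(\<lambda>t. Complex t (sqrt (1 - t\<^sup>2))) ` {0<..<1::real} \<subseteq> {z. cmod z = 1}"
    by (auto simp: cmod_def power_le_one)
  ultimately show ?thesis
    using infinite_super by blast
qed

text \<open>Needed because a solution of norm 0 is seen to vanish on the unit circle only.\<close>

lemma poly_eq_0_if_vanishes_on_unit_circle: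
  fixes p :: "complex poly"
  assumes "\<And>z. cmod z = 1 \<Longrightarrow> poly p z = 0"
  shows "p = 0"
proof (rule ccontr)
  assume "p \<noteq> 0"
  then have "finite {z. poly p z = 0}"
    by (rule poly_roots_finite)
  then show False
    using assms infinite_unit_circle by (metis (mono_tags, lifting) infinite_super mem_Collect_eq subsetI)
qed

lemma det_unitriangular:
  assumes A: "A \<in> carrier_mat n n" and diag: "\<And>i. i < n \<Longrightarrow> A $$ (i, i) = 1"
    and tri: "(\<forall>i j. i < j \<and> j < n \<longrightarrow> A $$ (i, j) = 0) \<or> (\<forall>i j. j < i \<and> i < n \<longrightarrow> A $$ (i, j) = 0)"
  shows "det A = (1 :: 'a :: comm_ring_1)"
proof -
  have "det A = prod_list (diag_mat A)"
    using tri
  proof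
    assume "\<forall>i j. i < j \<and> j < n \<longrightarrow> A $$ (i, j) = 0"
    then show ?thesis
      using A by (intro det_lower_triangular[where n = n]) auto
  next
    assume "\<forall>i j. j < i \<and> i < n \<longrightarrow> A $$ (i, j) = 0"
    then show ?thesis
      using A by (intro det_upper_triangular[where n = n]) (auto simp: upper_triangular_def)
  qed
  also have "\<dots> = 1"
    using A diag by (simp add: prod_list_diag_prod)
  finally show ?thesis .
qed

lemma det_cnj:
  assumes "A \<in> carrier_mat n n"
  shows "det (mat n n (\<lambda>(i, j). cnj (A $$ (i, j)))) = cnj (det A)"
proof -
  have "det (mat n n (\<lambda>(i, j). cnj (A $$ (i, j)))) =
      (\<Sum>p\<in>{p. p permutes {0..<n}}. signof p * (\<Prod>i = 0..<n. cnj (A $$ (i, p i))))"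
    unfolding det_def'[OF mat_carrier]
    by (intro sum.cong refl arg_cong2[of _ _ _ _ "(*)"] prod.cong) (auto dest: permutes_in_image)
  then show ?thesis
    using assms by (simp add: det_def'[where n = n])
qed

text \<open>The coupling of the \<open>L\<close> upper with the \<open>K - L\<close> lower rows. The lower left block of \<open>T\<close> is \<open>-w\<close>,
  and skewness makes the upper right block the conjugate transpose of \<open>w\<close>, so that the
  conditions of the two groups of rows come from matrices \<open>\<Phi>\<close> and \<open>\<Psi>\<close> that are adjoint inverses.\<close>

locale skew_coupling =
  fixes L K N :: nat and T :: "nat \<Rightarrow> nat \<Rightarrow> complex poly"
  assumes L_le_K: "L \<le> K"
    and degree_T: "degree (T a b) \<le> N"
    and T_skew: "T b a = - map_poly cnj (T a b)"
    and T_cross: "(a < L) = (b < L) \<Longrightarrow> T a b = 0"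
begin

abbreviation solution :: "(nat \<Rightarrow> complex poly) \<Rightarrow> bool" where
  "solution \<equiv> wh_solution K N T"

text \<open>The matrix entry encoded by \<open>p a\<close>: a polynomial in \<open>z\<close> in the upper rows and in \<open>1/z\<close> in the
  lower rows.\<close>

definition loop :: "(nat \<Rightarrow> complex poly) \<Rightarrow> nat \<Rightarrow> complex \<Rightarrow> complex" where
  "loop p a z = poly (p a) (if a < L then z else 1 / z)"

text \<open>The entry of \<open>U~ U\<close> at the columns \<open>q\<close> and \<open>p\<close>; on the unit circle it is their Hermitian inner
  product, as \<open>1 / cnj z = z\<close> there.\<close>

definition pairing :: "(nat \<Rightarrow> complex poly) \<Rightarrow> (nat \<Rightarrow> complex poly) \<Rightarrow> complex \<Rightarrow> complex" where
  "pairing q p z = (\<Sum>a<K. cnj (loop q a (1 / cnj z)) * loop p a z)"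

definition loop_mat :: "(nat \<Rightarrow> nat \<Rightarrow> complex poly) \<Rightarrow> complex \<Rightarrow> complex mat" where
  "loop_mat P z = mat K K (\<lambda>(a, j). loop (P j) a z)"

lemma loop_1: "loop p a 1 = poly (p a) 1"
  by (cases "a < L") (simp_all add: loop_def)

lemma sum_split: "(\<Sum>a<K. h a) = (\<Sum>a<L. h a) + (\<Sum>a = L..<K. h a)" for h :: "nat \<Rightarrow> complex"
  using L_le_K by (metis atLeast0LessThan sum.atLeastLessThan_concat zero_le)

lemma solution_lower:
  assumes "solution p" "a \<in> {L..<K}"
  shows "polyfun (\<lambda>z. poly (p a) (1 / z) + (\<Sum>b<L. poly (T a b) (1 / z) * poly (p b) z))"
proof -
  have "(\<Sum>b = L..<K. poly (T a b) (1 / z) * poly (p b) z) = 0" for z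
    using assms(2) by (intro sum.neutral) (auto simp: T_cross)
  moreover have "polyfun (\<lambda>z. poly (p a) (1 / z) + (\<Sum>b<K. poly (T a b) (1 / z) * poly (p b) z))"
    using assms by (simp add: wh_solution_def)
  ultimately show ?thesis
    by (simp add: sum_split)
qed

lemma solution_upper:
  assumes "solution p" "a \<in> {..<L}"
  shows "polyfun (\<lambda>z. poly (p a) (1 / z) + (\<Sum>b = L..<K. poly (T a b) (1 / z) * poly (p b) z))"
proof -
  have "(\<Sum>b<L. poly (T a b) (1 / z) * poly (p b) z) = 0" for z
    using assms(2) by (intro sum.neutral) (auto simp: T_cross)
  moreover have "polyfun (\<lambda>z. poly (p a) (1 / z) + (\<Sum>b<K. poly (T a b) (1 / z) * poly (p b) z))"
    using assms L_le_K by (simp add: wh_solution_def)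
  ultimately show ?thesis
    by (simp add: sum_split)
qed

text \<open>The pairing is in \<open>P\<^sup>+\<close> with the lower rows as first group, and in \<open>P\<^sup>-\<close> with the upper rows as
  first group.\<close>

lemma pairing_constant:
  assumes p: "solution p" and q: "solution q" and "z \<noteq> 0"
  shows "pairing q p z = pairing q p 1"
proof -
  have eq: "pairing q p z = (\<Sum>a = L..<K. cnj (poly (q a) (cnj z)) * poly (p a) (1 / z)) +
      (\<Sum>b<L. cnj (poly (q b) (1 / cnj z)) * poly (p b) z)" for z
    by (simp add: pairing_def sum_split loop_def)
  have "polyfun (pairing q p)"
    using coupled_solutions_pairing_polyfun[where A = "{L..<K}" and B = "{..<L}" and p = p and q = q,
        OF solution_lower[OF p] solution_upper[OF q] T_skew]
    by (simp add: eq[abs_def])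
  moreover have "polyfun (\<lambda>z. pairing q p (1 / z))"
    using coupled_solutions_pairing_polyfun[where A = "{..<L}" and B = "{L..<K}" and p = p and q = q,
        OF solution_upper[OF p] solution_lower[OF q] T_skew]
    by (simp add: eq add.commute)
  ultimately obtain c where "\<And>z. z \<noteq> 0 \<Longrightarrow> pairing q p z = c"
    by (rule polyfun_both_imp_constant) blast
  then show ?thesis
    using \<open>z \<noteq> 0\<close> by simp
qed

lemma pairing_unit_circle:
  assumes "cmod z = 1"
  shows "pairing q p z = (\<Sum>a<K. cnj (loop q a z) * loop p a z)"
proof -
  have "z * cnj z = 1"
    using assms by (simp add: complex_norm_square[symmetric])
  then have "1 / cnj z = z"
    by (metis complex_cnj_zero_iff mult_zero_right nonzero_eq_divide_eq zero_neq_one)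
  then show ?thesis
    by (simp add: pairing_def)
qed

lemma pairing_self:
  assumes "cmod z = 1"
  shows "pairing p p z = of_real (\<Sum>a<K. (cmod (loop p a z))\<^sup>2)"
  unfolding pairing_unit_circle[OF assms] of_real_sum
  by (intro sum.cong refl) (metis complex_norm_square mult.commute)

text \<open>If the norm were 0 at 1, it would be 0 on the whole unit circle, as it is constant there. The
  solution would then vanish at infinitely many points.\<close>

lemma solution_pairing_self_nonzero:
  assumes "solution p" "\<exists>a<K. p a \<noteq> 0"
  shows "(\<Sum>a<K. (cmod (loop p a 1))\<^sup>2) > 0"
proof (rule ccontr)
  assume "\<not> ?thesis"
  moreover have "(\<Sum>a<K. (cmod (loop p a 1))\<^sup>2) \<ge> 0"
    by (intro sum_nonneg) simp
  ultimately have "pairing p p 1 = 0"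
    by (simp add: pairing_self)
  have loop_0: "loop p a z = 0" if "a < K" "cmod z = 1" for a z
  proof -
    have "pairing p p z = 0"
      using pairing_constant[OF assms(1) assms(1), of z] \<open>pairing p p 1 = 0\<close> that(2)
      by (cases "z = 0") auto
    then have "(\<Sum>a<K. (cmod (loop p a z))\<^sup>2) = 0"
      unfolding pairing_self[OF that(2)] of_real_eq_0_iff .
    then show ?thesis
      using that(1) by (simp add: sum_nonneg_eq_0_iff)
  qed
  have "p a = 0" if "a < K" for a
  proof (rule poly_eq_0_if_vanishes_on_unit_circle)
    fix z :: complex
    assume z: "cmod z = 1"
    show "poly (p a) z = 0"
      using z loop_0[OF that, of z] loop_0[OF that, of "1 / z"]
      by (cases "a < L") (simp_all add: loop_def norm_divide)
  qed
  then show False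
    using assms(2) by blast
qed

lemma solution_smult:
  assumes "solution p"
  shows "solution (\<lambda>a. smult c (p a))"
proof -
  have "polyfun (\<lambda>z. c * (poly (p a) (1 / z) + (\<Sum>b<K. poly (T a b) (1 / z) * poly (p b) z)))"
    if "a < K" for a
    using assms that by (intro polyfun_mult polyfun_const) (simp add: wh_solution_def)
  then show ?thesis
    using assms by (auto simp: wh_solution_def distrib_left sum_distrib_left mult_ac intro: order_trans[OF degree_smult_le])
qed

lemma pairing_smult_right: "pairing q (\<lambda>a. smult c (p a)) z = c * pairing q p z"
  by (simp add: pairing_def loop_def sum_distrib_left mult_ac)

lemma pairing_smult_left: "pairing (\<lambda>a. smult c (q a)) p z = cnj c * pairing q p z"
  by (simp add: pairing_def loop_def sum_distrib_left mult_ac)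

lemma pairing_cnj: "pairing p q 1 = cnj (pairing q p 1)"
  by (simp add: pairing_def mult.commute)

text \<open>The Gram--Schmidt process without projections: orthogonality to the previous columns at 1 is
  imposed as additional linear equations.\<close>

lemma orthonormal_solutions:
  assumes "k \<le> K"
  shows "\<exists>P. (\<forall>j<k. solution (P j)) \<and>
    (\<forall>i<k. \<forall>j<k. pairing (P i) (P j) 1 = (if i = j then 1 else 0))"
  using assms
proof (induction k)
  case (Suc k)
  then obtain P where P: "\<And>j. j < k \<Longrightarrow> solution (P j)"
      "\<And>i j. i < k \<Longrightarrow> j < k \<Longrightarrow> pairing (P i) (P j) 1 = (if i = j then 1 else 0)"
    by auto
  have "k < K"
    using Suc.prems by simp
  obtain p where sol: "solution p" and p: "\<exists>a<K. p a \<noteq> 0"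
      "\<And>r. r < k \<Longrightarrow> (\<Sum>a<K. cnj (loop (P r) a 1) * poly (p a) 1) = 0"
    using wiener_hopf_system_solvable[where T = T and N = N and c = "\<lambda>r a. cnj (loop (P r) a 1)",
        OF degree_T \<open>k < K\<close>]
    by blast
  define s where "s = (\<Sum>a<K. (cmod (loop p a 1))\<^sup>2)"
  have "s > 0"
    using solution_pairing_self_nonzero[OF sol p(1)] by (simp add: s_def)
  define c where "c = complex_of_real (1 / sqrt s)"
  have "cnj c * c = of_real (1 / sqrt s * (1 / sqrt s))"
    unfolding c_def complex_cnj_complex_of_real of_real_mult ..
  also have "1 / sqrt s * (1 / sqrt s) = 1 / s"
    using \<open>s > 0\<close> by simp
  finally have "cnj c * c = of_real (1 / s)" .
  moreover have "pairing p p 1 = of_real s"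
    unfolding s_def by (rule pairing_self) simp
  ultimately have norm: "cnj c * c * pairing p p 1 = 1"
    using \<open>s > 0\<close> by (simp flip: of_real_mult)
  have orth: "pairing (P r) p 1 = 0" "pairing p (P r) 1 = 0" if "r < k" for r
  proof -
    show "pairing (P r) p 1 = 0"
      using p(2)[OF that] by (simp add: pairing_def loop_1)
    then show "pairing p (P r) 1 = 0"
      using pairing_cnj[of p "P r"] by simp
  qed
  show ?case
  proof (intro exI[of _ "P(k := \<lambda>a. smult c (p a))"] conjI allI impI)
    show "solution ((P(k := \<lambda>a. smult c (p a))) j)" if "j < Suc k" for j
      using that P(1) solution_smult[OF sol] by (auto simp: less_Suc_eq)
    show "pairing ((P(k := \<lambda>a. smult c (p a))) i) ((P(k := \<lambda>a. smult c (p a))) j) 1 =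
        (if i = j then 1 else 0)" if "i < Suc k" "j < Suc k" for i j
      using that P(2) orth norm
      by (auto simp: less_Suc_eq pairing_smult_left pairing_smult_right mult_ac)
  qed
qed simp

text \<open>Multiplication by the unipotent matrix \<open>\<Phi>\<close> does not change the determinant, and turns all entries
  into polynomials: it adds to the rows in \<open>S\<close>, which are polynomials in \<open>1/z\<close>, exactly the sums
  that occur in the conditions on solutions. For \<open>S = {L..}\<close> this is the matrix \<open>\<Phi>\<close> of the
  introduction, for \<open>S = {..<L}\<close> it is \<open>\<Psi>\<close> at \<open>1/z\<close>.\<close>

lemma det_coupled_columns_polyfun:
  assumes sol: "\<And>j. j < K \<Longrightarrow> solution (P j)"
    and S: "S = {..<L} \<or> S = {L..}"
  shows "polyfun (\<lambda>z. det (mat K K (\<lambda>(a, j). poly (P j a) (if a \<in> S then 1 / z else z))))"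
proof -
  define V where "V z = mat K K (\<lambda>(a, j). poly (P j a) (if a \<in> S then 1 / z else z))" for z
  define \<Phi> where "\<Phi> z = mat K K (\<lambda>(a, b).
    (if a = b then 1 else 0) + (if a \<in> S then poly (T a b) (1 / z) else 0))" for z
  have [simp]: "V z \<in> carrier_mat K K" "\<Phi> z \<in> carrier_mat K K" for z
    by (simp_all add: V_def \<Phi>_def)
  have "det (\<Phi> z) = 1" for z
    using S by (intro det_unitriangular[where n = K]) (auto simp: \<Phi>_def T_cross)
  then have "det (V z) = det (\<Phi> z * V z)" for z
    by (simp add: det_mult[where n = K])
  moreover have "polyfun (\<lambda>z. det (\<Phi> z * V z))"
  proof (rule polyfun_det)
    fix a j
    assume aj: "a < K" "j < K"
    have "(\<Phi> z * V z) $$ (a, j) = (if a \<in> S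
        then poly (P j a) (1 / z) + (\<Sum>b<K. poly (T a b) (1 / z) * poly (P j b) z)
        else poly (P j a) z)" for z
    proof -
      have "(\<Phi> z * V z) $$ (a, j) = (\<Sum>b<K.
          ((if a = b then 1 else 0) + (if a \<in> S then poly (T a b) (1 / z) else 0)) *
          poly (P j b) (if b \<in> S then 1 / z else z))"
        using aj by (simp add: \<Phi>_def V_def scalar_prod_def atLeast0LessThan)
      also have "\<dots> = (\<Sum>b<K. (if a = b then poly (P j b) (if b \<in> S then 1 / z else z) else 0)) +
          (\<Sum>b<K. (if a \<in> S then poly (T a b) (1 / z) * poly (P j b) z else 0))"
        unfolding sum.distrib[symmetric] using S
        by (intro sum.cong refl) (auto simp: T_cross distrib_right)
      finally show ?thesis
        using aj by simp
    qed
    then show "polyfun (\<lambda>z. (\<Phi> z * V z) $$ (a, j))"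
      using sol[OF aj(2)] aj(1) polyfun_poly by (cases "a \<in> S") (auto simp: wh_solution_def)
  qed (rule mult_carrier_mat[where n = K], simp_all)
  ultimately show ?thesis
    by (simp add: V_def)
qed

lemma det_loop_mat_constant:
  assumes "\<And>j. j < K \<Longrightarrow> solution (P j)" and "z \<noteq> 0"
  shows "det (loop_mat P z) = det (loop_mat P 1)"
proof -
  have "loop_mat P z = mat K K (\<lambda>(a, j). poly (P j a) (if a \<in> {L..} then 1 / z else z))" for z
    unfolding loop_mat_def loop_def by (intro cong_mat) auto
  then have "polyfun (\<lambda>z. det (loop_mat P z))"
    using det_coupled_columns_polyfun[OF assms(1), where S = "{L..}"] by simp
  moreover have "loop_mat P (1 / z) =
      mat K K (\<lambda>(a, j). poly (P j a) (if a \<in> {..<L} then 1 / z else z))" for z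
    unfolding loop_mat_def loop_def by (intro cong_mat) auto
  then have "polyfun (\<lambda>z. det (loop_mat P (1 / z)))"
    using det_coupled_columns_polyfun[OF assms(1), where S = "{..<L}"] by simp
  ultimately obtain c where "\<And>z. z \<noteq> 0 \<Longrightarrow> det (loop_mat P z) = c"
    by (rule polyfun_both_imp_constant) blast
  then show ?thesis
    using \<open>z \<noteq> 0\<close> by simp
qed

lemma orthonormal_imp_cmod_det:
  assumes "\<And>i j. i < K \<Longrightarrow> j < K \<Longrightarrow> pairing (P i) (P j) 1 = (if i = j then 1 else 0)"
  shows "cnj (det (loop_mat P 1)) * det (loop_mat P 1) = 1"
proof -
  define U where "U = loop_mat P 1"
  define V where "V = mat K K (\<lambda>(a, j). cnj (U $$ (a, j)))"
  have carr: "U \<in> carrier_mat K K" "V \<in> carrier_mat K K"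
    by (simp_all add: U_def V_def loop_mat_def)
  have "transpose_mat V * U = 1\<^sub>m K"
  proof (rule eq_matI)
    fix i j
    assume "i < dim_row (1\<^sub>m K :: complex mat)" "j < dim_col (1\<^sub>m K :: complex mat)"
    then show "(transpose_mat V * U) $$ (i, j) = 1\<^sub>m K $$ (i, j)"
      using assms[of i j]
      by (simp add: V_def U_def loop_mat_def scalar_prod_def pairing_def atLeast0LessThan)
  qed (use carr in auto)
  then have "det (transpose_mat V) * det U = 1"
    using carr by (metis det_mult det_one transpose_carrier_mat)
  moreover have "det (transpose_mat V) = cnj (det U)"
    using carr det_cnj[OF carr(1)] by (simp add: det_transpose[where n = K] V_def)
  ultimately show ?thesis
    by (simp add: U_def)
qed

text \<open>Multiplying a single column by a number of modulus 1 preserves orthonormality and adjusts the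
  determinant.\<close>

proposition unimodular_orthonormal_solutions:
  assumes "K > 0"
  obtains P where "\<And>j. j < K \<Longrightarrow> solution (P j)"
    "\<And>i j z. i < K \<Longrightarrow> j < K \<Longrightarrow> z \<noteq> 0 \<Longrightarrow> pairing (P i) (P j) z = (if i = j then 1 else 0)"
    "\<And>z. z \<noteq> 0 \<Longrightarrow> det (loop_mat P z) = 1"
proof -
  obtain P where P: "\<And>j. j < K \<Longrightarrow> solution (P j)"
      "\<And>i j. i < K \<Longrightarrow> j < K \<Longrightarrow> pairing (P i) (P j) 1 = (if i = j then 1 else 0)"
    using orthonormal_solutions[of K] by auto
  define d where "d = det (loop_mat P 1)"
  have d: "cnj d * d = 1"
    using orthonormal_imp_cmod_det[OF P(2)] by (simp add: d_def)
  define c where "c j = (if j = 0 then cnj d else 1)" for j :: nat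
  have c: "cnj (c j) * c j = 1" for j
    using d by (simp add: c_def mult.commute)
  define Q where "Q j a = smult (c j) (P j a)" for j a
  have sol: "solution (Q j)" if "j < K" for j
    using solution_smult[OF P(1)[OF that]] by (simp add: Q_def[abs_def])
  have orth: "pairing (Q i) (Q j) z = (if i = j then 1 else 0)" if "i < K" "j < K" "z \<noteq> 0" for i j z
  proof -
    have "pairing (Q i) (Q j) z = cnj (c i) * c j * pairing (P i) (P j) 1"
      unfolding pairing_constant[OF sol[OF that(2)] sol[OF that(1)] that(3)]
      by (simp add: Q_def[abs_def] pairing_smult_left pairing_smult_right)
    then show ?thesis
      using P(2)[OF that(1,2)] c by simp
  qed
  have det: "det (loop_mat Q z) = 1" if "z \<noteq> 0" for z
  proof -
    define D where "D = mat K K (\<lambda>(i, j). if i = j then c j else 0)"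
    have "loop_mat Q 1 = loop_mat P 1 * D"
    proof (rule eq_matI)
      fix a j
      assume "a < dim_row (loop_mat P 1 * D)" "j < dim_col (loop_mat P 1 * D)"
      then have aj: "a < K" "j < K"
        by (simp_all add: loop_mat_def D_def)
      then have "(loop_mat P 1 * D) $$ (a, j) = (\<Sum>b<K. if b = j then loop (P b) a 1 * c j else 0)"
        by (simp add: loop_mat_def D_def scalar_prod_def atLeast0LessThan if_distrib cong: if_cong)
      then show "loop_mat Q 1 $$ (a, j) = (loop_mat P 1 * D) $$ (a, j)"
        using aj by (simp add: loop_mat_def loop_def Q_def mult.commute)
    qed (simp_all add: loop_mat_def D_def)
    moreover have "det D = cnj d"
    proof -
      have "det D = prod_list (diag_mat D)"
        by (rule det_upper_triangular[where n = K]) (auto simp: D_def upper_triangular_def)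
      also have "\<dots> = (\<Prod>i = 0..<K. c i)"
        by (simp add: prod_list_diag_prod D_def)
      also have "\<dots> = cnj d"
        using assms by (simp add: c_def)
      finally show ?thesis .
    qed
    ultimately have "det (loop_mat Q 1) = d * cnj d"
      by (simp add: det_mult[where n = K] loop_mat_def D_def d_def)
    then show ?thesis
      using det_loop_mat_constant[of Q z, OF sol that] d by (simp add: mult.commute)
  qed
  show ?thesis
    by (rule that[of Q, OF sol orth det])
qed

end

section \<open>Elimination of the entry f\<close>

lemma polyfun_reversed:
  assumes "degree p \<le> N"
  shows "polyfun (\<lambda>z. z ^ N * poly p (1 / z))"
proof (rule polyfunI[of _ "\<Sum>i\<le>N. monom (coeff p i) (N - i)"])
  fix z :: complex
  assume "z \<noteq> 0"
  then show "z ^ N * poly p (1 / z) = poly (\<Sum>i\<le>N. monom (coeff p i) (N - i)) z"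
    unfolding poly_altdef_le[OF assms] sum_distrib_left poly_sum poly_monom
    by (intro sum.cong) (auto simp: power_diff power_divide)
qed

text \<open>The lowest coefficient \<open>h(0)\<close> of the pole \<open>h(z) / z\<^sup>N\<close> is cancelled by adding \<open>f(z) c / z\<^sup>N\<close> with
  \<open>f(0) c = -h(0)\<close>; this leaves a pole of order \<open>N - 1\<close>.\<close>

lemma pole_cancelled_by_negative_powers:
  fixes f :: "nat \<Rightarrow> nat \<Rightarrow> complex poly"
  assumes onto: "\<And>h. \<exists>c. \<forall>r<M. (\<Sum>s<M. poly (f r s) 0 * c s) = h r"
  shows "\<exists>w. (\<forall>s. degree (w s) \<le> N) \<and>
    (\<forall>r<M. polyfun (\<lambda>z. poly (h r) z * (1 / z) ^ N + (\<Sum>s<M. poly (f r s) z * poly (w s) (1 / z))))"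
proof (induction N arbitrary: h)
  case 0
  show ?case
    by (intro exI[of _ "\<lambda>_. 0"]) (simp add: polyfun_poly)
next
  case (Suc N)
  obtain c where c: "\<And>r. r < M \<Longrightarrow> (\<Sum>s<M. poly (f r s) 0 * c s) = - poly (h r) 0"
    using onto[of "\<lambda>r. - poly (h r) 0"] by blast
  have "\<exists>q. r < M \<longrightarrow> h r + (\<Sum>s<M. smult (c s) (f r s)) = pCons 0 q" for r
  proof (cases "r < M")
    case True
    obtain a q where q: "h r + (\<Sum>s<M. smult (c s) (f r s)) = pCons a q"
      by (rule pCons_cases)
    have "a = poly (h r + (\<Sum>s<M. smult (c s) (f r s))) 0"
      by (simp add: q)
    also have "\<dots> = 0"
      using c[OF True] by (simp add: poly_sum mult.commute)
    finally show ?thesis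
      using q by blast
  qed simp
  then obtain h' where h': "\<And>r. r < M \<Longrightarrow> h r + (\<Sum>s<M. smult (c s) (f r s)) = pCons 0 (h' r)"
    by metis
  from Suc.IH[of h'] obtain w where w: "\<And>s. degree (w s) \<le> N"
      "\<And>r. r < M \<Longrightarrow>
        polyfun (\<lambda>z. poly (h' r) z * (1 / z) ^ N + (\<Sum>s<M. poly (f r s) z * poly (w s) (1 / z)))"
    by blast
  show ?case
  proof (intro exI[of _ "\<lambda>s. w s + monom (c s) (Suc N)"] conjI allI impI)
    show "degree (w s + monom (c s) (Suc N)) \<le> Suc N" for s
      using w(1)[of s] by (intro degree_add_le) (auto intro: degree_monom_le order_trans)
    fix r
    assume r: "r < M"
    have "poly (h r) z * (1 / z) ^ Suc N +
          (\<Sum>s<M. poly (f r s) z * poly (w s + monom (c s) (Suc N)) (1 / z)) =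
        poly (h' r) z * (1 / z) ^ N + (\<Sum>s<M. poly (f r s) z * poly (w s) (1 / z))"
      if "z \<noteq> 0" for z
    proof -
      have "(\<Sum>s<M. poly (f r s) z * poly (w s + monom (c s) (Suc N)) (1 / z)) =
          (\<Sum>s<M. poly (f r s) z * poly (w s) (1 / z)) +
          poly (\<Sum>s<M. smult (c s) (f r s)) z * (1 / z) ^ Suc N"
        by (simp add: poly_sum poly_monom distrib_left sum.distrib sum_distrib_left mult_ac)
      moreover have "poly (h r) z + poly (\<Sum>s<M. smult (c s) (f r s)) z = z * poly (h' r) z"
        using arg_cong[OF h'[OF r], of "\<lambda>p. poly p z"] by simp
      moreover have "z * (1 / z) ^ Suc N = (1 / z) ^ N"
        using that by simp
      moreover have "poly (h r) z * (1 / z) ^ Suc N + poly (\<Sum>s<M. smult (c s) (f r s)) z * (1 / z) ^ Suc N =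
          (poly (h r) z + poly (\<Sum>s<M. smult (c s) (f r s)) z) * (1 / z) ^ Suc N"
        by (simp only: distrib_right)
      ultimately show ?thesis
        using that by (simp add: mult_ac)
    qed
    then show "polyfun (\<lambda>z. poly (h r) z * (1 / z) ^ Suc N +
        (\<Sum>s<M. poly (f r s) z * poly (w s + monom (c s) (Suc N)) (1 / z)))"
      using w(2)[OF r] by (subst polyfun_cong) auto
  qed
qed

lemma negative_part_absorbed:
  fixes f :: "nat \<Rightarrow> nat \<Rightarrow> complex poly"
  assumes "\<And>h. \<exists>c. \<forall>r<M. (\<Sum>s<M. poly (f r s) 0 * c s) = h r"
    and "\<And>r. r < M \<Longrightarrow> degree (q r) \<le> N"
  shows "\<exists>w. (\<forall>s. degree (w s) \<le> N) \<and>
    (\<forall>r<M. polyfun (\<lambda>z. poly (q r) (1 / z) + (\<Sum>s<M. poly (f r s) z * poly (w s) (1 / z))))"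
proof -
  have "\<exists>h. r < M \<longrightarrow> (\<forall>z. z \<noteq> 0 \<longrightarrow> z ^ N * poly (q r) (1 / z) = poly h z)" for r
    using polyfun_reversed[OF assms(2)] unfolding polyfun_def by blast
  then obtain h where h: "\<And>r z. r < M \<Longrightarrow> z \<noteq> 0 \<Longrightarrow> z ^ N * poly (q r) (1 / z) = poly (h r) z"
    by metis
  obtain w where w: "\<And>s. degree (w s) \<le> N" "\<And>r. r < M \<Longrightarrow>
      polyfun (\<lambda>z. poly (h r) z * (1 / z) ^ N + (\<Sum>s<M. poly (f r s) z * poly (w s) (1 / z)))"
    using pole_cancelled_by_negative_powers[OF assms(1), of N h] by blast
  have "poly (q r) (1 / z) = poly (h r) z * (1 / z) ^ N" if "r < M" "z \<noteq> 0" for r z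
    using that by (simp flip: h add: power_divide)
  then have "polyfun (\<lambda>z. poly (q r) (1 / z) + (\<Sum>s<M. poly (f r s) z * poly (w s) (1 / z)))"
    if "r < M" for r
    using w(2)[OF that] that by (subst polyfun_cong) auto
  with w(1) show ?thesis
    by blast
qed

text \<open>The theorem for scalar entries, without the block structure: the last rows of \<open>F\<close> consist of
  \<open>Z (1/z)\<close> and \<open>f (z)\<close>, and \<open>P j a\<close> encodes the entry in row \<open>a\<close> and column \<open>j\<close> of \<open>U\<close>. The polynomials
  \<open>g\<close> are the entries of the last rows of \<open>F U\<close>.\<close>

proposition entrywise_paraunitary_completion:
  fixes L M N :: nat and Z f :: "nat \<Rightarrow> nat \<Rightarrow> complex poly"
  assumes Z: "\<And>r b. r < M \<Longrightarrow> b < L \<Longrightarrow> degree (Z r b) \<le> N"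
    and f: "\<And>r s. r < M \<Longrightarrow> s < M \<Longrightarrow> degree (f r s) \<le> N"
    and onto: "\<And>h. \<exists>c. \<forall>r<M. (\<Sum>s<M. poly (f r s) 0 * c s) = h r"
    and "M > 0"
  obtains P g :: "nat \<Rightarrow> nat \<Rightarrow> complex poly" where
    "\<And>a j. j < L + M \<Longrightarrow> degree (P j a) \<le> N"
    "\<And>i j z. i < L + M \<Longrightarrow> j < L + M \<Longrightarrow> z \<noteq> 0 \<Longrightarrow>
      (\<Sum>a<L + M. cnj (poly (P i a) (if a < L then 1 / cnj z else cnj z)) *
        poly (P j a) (if a < L then z else 1 / z)) = (if i = j then 1 else 0)"
    "\<And>z. z \<noteq> 0 \<Longrightarrow>
      det (mat (L + M) (L + M) (\<lambda>(a, j). poly (P j a) (if a < L then z else 1 / z))) = 1"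
    "\<And>r j. r < M \<Longrightarrow> j < L + M \<Longrightarrow> degree (g r j) \<le> N"
    "\<And>r j z. r < M \<Longrightarrow> j < L + M \<Longrightarrow> z \<noteq> 0 \<Longrightarrow>
      (\<Sum>b<L. poly (Z r b) (1 / z) * poly (P j b) z) +
      (\<Sum>s<M. poly (f r s) z * poly (P j (L + s)) (1 / z)) = poly (g r j) z"
proof -
  define absorbs where "absorbs b w \<longleftrightarrow> (\<forall>s. degree (w s) \<le> N) \<and>
      (\<forall>r<M. polyfun (\<lambda>z. poly (Z r b) (1 / z) + (\<Sum>s<M. poly (f r s) z * poly (w s) (1 / z))))" for b w
  have ex_w: "\<exists>w. absorbs b w" if "b < L" for b
    unfolding absorbs_def by (rule negative_part_absorbed[OF onto Z[OF _ that]])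
  define w where "w b = (SOME w. absorbs b w)" for b
  have absorbs: "absorbs b (w b)" if "b < L" for b
    unfolding w_def by (rule someI_ex[OF ex_w[OF that]])
  have w: "\<And>b s. b < L \<Longrightarrow> degree (w b s) \<le> N"
      "\<And>b r. b < L \<Longrightarrow> r < M \<Longrightarrow>
        polyfun (\<lambda>z. poly (Z r b) (1 / z) + (\<Sum>s<M. poly (f r s) z * poly (w b s) (1 / z)))"
    using absorbs by (simp_all add: absorbs_def)
  define T where "T a b =
    (if L \<le> a \<and> b < L then - w b (a - L)
     else if a < L \<and> L \<le> b then map_poly cnj (w a (b - L)) else 0)" for a b
  interpret skew_coupling L "L + M" N T
  proof
    show "degree (T a b) \<le> N" for a b
      using w(1) by (auto simp: T_def intro: order_trans[OF degree_map_poly_le])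
    show "T b a = - map_poly cnj (T a b)" for a b
      by (rule poly_eqI) (auto simp: T_def coeff_map_poly)
    show "T a b = 0" if "(a < L) = (b < L)" for a b
      using that by (auto simp: T_def)
  qed simp
  obtain P where P: "\<And>j. j < L + M \<Longrightarrow> solution (P j)"
    "\<And>i j z. i < L + M \<Longrightarrow> j < L + M \<Longrightarrow> z \<noteq> 0 \<Longrightarrow> pairing (P i) (P j) z = (if i = j then 1 else 0)"
    "\<And>z. z \<noteq> 0 \<Longrightarrow> det (loop_mat P z) = 1"
    by (rule unimodular_orthonormal_solutions) (use \<open>M > 0\<close> in simp, blast)
  have deg_P: "degree (P j a) \<le> N" if "j < L + M" for j a
    using P(1)[OF that] by (simp add: wh_solution_def)
  define G where "G r j z = (\<Sum>b<L. poly (Z r b) (1 / z) * poly (P j b) z) +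
      (\<Sum>s<M. poly (f r s) z * poly (P j (L + s)) (1 / z))" for r j z
  have ex_g: "\<exists>p. degree p \<le> N \<and> (\<forall>z. z \<noteq> 0 \<longrightarrow> G r j z = poly p z)" if r: "r < M" and j: "j < L + M" for r j
  proof -
    define E where "E s z = poly (P j (L + s)) (1 / z) +
        (\<Sum>b<L. poly (T (L + s) b) (1 / z) * poly (P j b) z)" for s z
    \<comment> \<open>The identity \<open>\<zeta> x + f y = (\<zeta> + f w) x + f (y - w x)\<close>.\<close>
    have G_eq: "G r j z =
        (\<Sum>b<L. (poly (Z r b) (1 / z) + (\<Sum>s<M. poly (f r s) z * poly (w b s) (1 / z))) * poly (P j b) z) +
        (\<Sum>s<M. poly (f r s) z * E s z)" for z
    proof -
      have "(\<Sum>s<M. poly (f r s) z * E s z) = (\<Sum>s<M. poly (f r s) z * poly (P j (L + s)) (1 / z)) -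
          (\<Sum>s<M. \<Sum>b<L. poly (f r s) z * (poly (w b s) (1 / z) * poly (P j b) z))"
        by (simp add: E_def T_def distrib_left right_diff_distrib sum_negf sum_subtractf sum_distrib_left)
      moreover have "(\<Sum>s<M. \<Sum>b<L. poly (f r s) z * (poly (w b s) (1 / z) * poly (P j b) z)) =
          (\<Sum>b<L. \<Sum>s<M. poly (f r s) z * (poly (w b s) (1 / z) * poly (P j b) z))"
        by (rule sum.swap)
      ultimately show ?thesis
        by (simp add: G_def distrib_left distrib_right sum.distrib sum_distrib_left sum_distrib_right mult_ac)
    qed
    have E: "polyfun (\<lambda>z. E s z)" if "s < M" for s
      unfolding E_def using that by (intro solution_lower[OF P(1)[OF j]]) simp
    have "polyfun (\<lambda>z. G r j z)"
      unfolding G_eq using r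
      by (intro polyfun_add polyfun_sum polyfun_mult polyfun_poly w(2) E) auto
    then obtain p where p: "\<And>z. z \<noteq> 0 \<Longrightarrow> G r j z = poly p z"
      by (rule polyfunE) blast
    \<comment> \<open>No exponent above \<open>N\<close> occurs, because \<open>\<zeta>\<close> and \<open>y\<close> have no positive exponents.\<close>
    have "z ^ N * G r j (1 / z) =
        (\<Sum>b<L. poly (Z r b) z * (z ^ N * poly (P j b) (1 / z))) +
        (\<Sum>s<M. (z ^ N * poly (f r s) (1 / z)) * poly (P j (L + s)) z)" for z
      by (simp add: G_def distrib_left sum_distrib_left mult_ac)
    then have "polyfun (\<lambda>z. z ^ N * G r j (1 / z))"
      using deg_P[OF j] f[OF r]
      by (simp only:) (intro polyfun_add polyfun_sum polyfun_mult polyfun_poly polyfun_reversed, auto)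
    then have "polyfun (\<lambda>z. z ^ N * poly p (1 / z))"
      using p by (subst (asm) polyfun_cong) auto
    then have "degree p \<le> N"
      by (rule polyfun_imp_degree_le)
    with p show ?thesis
      by blast
  qed
  define g where "g r j = (SOME p. degree p \<le> N \<and> (\<forall>z. z \<noteq> 0 \<longrightarrow> G r j z = poly p z))" for r j
  have g: "\<And>r j. r < M \<Longrightarrow> j < L + M \<Longrightarrow> degree (g r j) \<le> N"
      "\<And>r j z. r < M \<Longrightarrow> j < L + M \<Longrightarrow> z \<noteq> 0 \<Longrightarrow> G r j z = poly (g r j) z"
    using someI_ex[OF ex_g] unfolding g_def by blast+
  have orth: "(\<Sum>a<L + M. cnj (poly (P i a) (if a < L then 1 / cnj z else cnj z)) *
        poly (P j a) (if a < L then z else 1 / z)) = (if i = j then 1 else 0)"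
    if "i < L + M" "j < L + M" "z \<noteq> 0" for i j z
    using P(2)[OF that] by (simp add: pairing_def loop_def cong: if_cong)
  show ?thesis
    by (rule that[of P g, OF deg_P orth P(3)[unfolded loop_mat_def loop_def] g(1) g(2)[unfolded G_def]])
qed

section \<open>Coefficient sequences and blocks\<close>

lemma mat_adjoint_index:
  assumes "i < dim_col A" "j < dim_row A"
  shows "mat_adjoint A $$ (i, j) = conjugate (A $$ (j, i))"
  using assms unfolding mat_adjoint_def by (simp add: mat_of_rows_index)

lemma mat_adjoint_carrier: "A \<in> carrier_mat n n' \<Longrightarrow> mat_adjoint A \<in> carrier_mat n' n"
  unfolding mat_adjoint_def by (metis carrier_matD cols_length length_map mat_of_rows_carrier(1))

lemma laurent_polys_mono:
  "P \<in> laurent_polys n1 n2 K \<Longrightarrow> n1 \<le> n1' \<Longrightarrow> n2 \<le> n2' \<Longrightarrow> P \<in> laurent_polys n1' n2' K"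
  unfolding laurent_polys_def by auto

lemma laurent_adj_in_laurent_polys:
  assumes "P \<in> laurent_polys n1 n2 K"
  shows "laurent_adj P \<in> laurent_polys n2 n1 K"
proof -
  have "mat_adjoint (0\<^sub>m K K :: complex mat) = 0\<^sub>m K K"
    by (rule eq_matI) (use mat_adjoint_carrier[of "0\<^sub>m K K" K K] in \<open>auto simp: mat_adjoint_index\<close>)
  then show ?thesis
    using assms unfolding laurent_polys_def laurent_adj_def by (auto intro: mat_adjoint_carrier)
qed

lemma laurent_const_in_laurent_polys:
  "A \<in> carrier_mat K K \<Longrightarrow> laurent_const A \<in> laurent_polys n1 n2 K"
  by (auto simp: laurent_polys_def laurent_const_def)

lemma block_index_less:
  fixes a m M :: nat
  assumes "a < m * M"
  shows "a div M < m" "a mod M < M"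
proof -
  have "M > 0"
    using assms by (cases M) auto
  then show "a div M < m" "a mod M < M"
    using assms by (simp_all add: div_less_iff_less_mult)
qed

lemma block_laurent_in_laurent_polys:
  assumes "\<And>i j. i < m \<Longrightarrow> j < m \<Longrightarrow> B i j \<in> laurent_polys n1 n2 M"
  shows "block_laurent m M B \<in> laurent_polys n1 n2 (m * M)"
proof -
  have "block_laurent m M B n = 0\<^sub>m (m * M) (m * M)" if "n < - int n1 \<or> int n2 < n" for n
  proof (rule eq_matI)
    fix a b
    assume "a < dim_row (0\<^sub>m (m * M) (m * M))" "b < dim_col (0\<^sub>m (m * M) (m * M))"
    then have ab: "a < m * M" "b < m * M"
      by auto
    then have "B (a div M) (b div M) n = 0\<^sub>m M M"
      using assms[OF block_index_less(1)[OF ab(1)] block_index_less(1)[OF ab(2)]] that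
      unfolding laurent_polys_def by blast
    then show "block_laurent m M B n $$ (a, b) = 0\<^sub>m (m * M) (m * M) $$ (a, b)"
      using ab block_index_less(2)[OF ab(1)] block_index_less(2)[OF ab(2)]
      by (simp add: block_laurent_def)
  qed (simp_all add: block_laurent_def)
  then show ?thesis
    unfolding laurent_polys_def by (auto simp: block_laurent_def)
qed

lemma laurent_eval_carrier: "laurent_eval K P z \<in> carrier_mat K K"
  by (simp add: laurent_eval_def)

lemma laurent_eval_entry:
  assumes "P \<in> laurent_polys n1 n2 K" "i < K" "j < K"
  shows "laurent_eval K P z $$ (i, j) = (\<Sum>n = - int n1..int n2. P n $$ (i, j) * z powi n)"
  unfolding laurent_eval_altdef[OF assms(1)] using assms(2,3) by simp

lemma laurent_eval_entry_poly:
  assumes P: "P \<in> laurent_polys n1 n2 K" and ij: "i < K" "j < K" and deg: "degree q \<le> n2"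
    and coeff: "\<And>n. P n $$ (i, j) = (if n \<ge> 0 then coeff q (nat n) else 0)"
  shows "laurent_eval K P z $$ (i, j) = poly q z"
proof -
  have "laurent_eval K P z $$ (i, j) = (\<Sum>n = 0..int n2. coeff q (nat n) * z powi n)"
    unfolding laurent_eval_entry[OF P ij] by (rule sum.mono_neutral_cong_right) (auto simp: coeff)
  also have "\<dots> = (\<Sum>k\<le>n2. coeff q k * z ^ k)"
    by (rule sum.reindex_bij_witness[of _ int nat]) (auto simp: power_int_def)
  also have "\<dots> = poly q z"
    using deg by (simp add: poly_altdef_le)
  finally show ?thesis .
qed

lemma laurent_eval_entry_poly_inverse:
  assumes P: "P \<in> laurent_polys n1 n2 K" and ij: "i < K" "j < K" and deg: "degree q \<le> n1"
    and coeff: "\<And>n. P n $$ (i, j) = (if n \<le> 0 then coeff q (nat (- n)) else 0)"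
  shows "laurent_eval K P z $$ (i, j) = poly q (1 / z)"
proof -
  have "laurent_eval K P z $$ (i, j) = (\<Sum>n = - int n1..0. coeff q (nat (- n)) * z powi n)"
    unfolding laurent_eval_entry[OF P ij] by (rule sum.mono_neutral_cong_right) (auto simp: coeff)
  also have "\<dots> = (\<Sum>k\<le>n1. coeff q k * (1 / z) ^ k)"
    by (rule sum.reindex_bij_witness[of _ "\<lambda>k. - int k" "\<lambda>n. nat (- n)"])
       (auto simp: power_int_def inverse_eq_divide)
  also have "\<dots> = poly q (1 / z)"
    using deg by (simp add: poly_altdef_le)
  finally show ?thesis .
qed

lemma laurent_eval_adj:
  assumes P: "P \<in> laurent_polys n1 n2 K" and ij: "i < K" "j < K"
  shows "laurent_eval K (laurent_adj P) z $$ (i, j) = cnj (laurent_eval K P (1 / cnj z) $$ (j, i))"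
proof -
  have carr: "P n \<in> carrier_mat K K" for n
    using P by (simp add: laurent_polys_def)
  have "laurent_eval K (laurent_adj P) z $$ (i, j) =
      (\<Sum>n = - int n2..int n1. cnj (P (- n) $$ (j, i)) * z powi n)"
    unfolding laurent_eval_entry[OF laurent_adj_in_laurent_polys[OF P] ij]
    using ij carrier_matD[OF carr] by (intro sum.cong refl) (simp add: laurent_adj_def mat_adjoint_index)
  also have "\<dots> = (\<Sum>n = - int n1..int n2. cnj (P n $$ (j, i) * (1 / cnj z) powi n))"
    by (rule sum.reindex_bij_witness[of _ uminus uminus])
       (auto simp: power_int_minus power_int_divide_distrib inverse_eq_divide)
  also have "\<dots> = cnj (laurent_eval K P (1 / cnj z) $$ (j, i))"
    unfolding laurent_eval_entry[OF P ij(2,1)] by simp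
  finally show ?thesis .
qed

lemma sum_lessThan_add:
  fixes h :: "nat \<Rightarrow> 'a::comm_monoid_add"
  shows "(\<Sum>c<L + M. h c) = (\<Sum>b<L. h b) + (\<Sum>s<M. h (L + s))"
  by (induction M) (simp_all add: add.assoc)

definition poly_block :: "nat \<Rightarrow> (nat \<Rightarrow> nat \<Rightarrow> complex poly) \<Rightarrow> laurent_mat" where
  "poly_block M q n = mat M M (\<lambda>(r, s). if n \<ge> 0 then coeff (q r s) (nat n) else 0)"

lemma poly_block_in_polys_plus:
  assumes "\<And>r s. r < M \<Longrightarrow> s < M \<Longrightarrow> degree (q r s) \<le> N"
  shows "poly_block M q \<in> polys_plus N M"
proof -
  have "coeff (q r s) (nat n) = 0" if "r < M" "s < M" "int N < n" for r s n
    using assms[OF that(1,2)] that(3) by (intro coeff_eq_0) linarith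
  then show ?thesis
    unfolding polys_plus_def laurent_polys_def poly_block_def by (auto intro!: eq_matI)
qed

theorem theorem1:
  fixes M m N :: nat
    and \<zeta> :: "nat \<Rightarrow> laurent_mat"
    and f F :: laurent_mat
  assumes "M > 0" and "m > 0" and "N > 0"
    and "\<forall>j<m - 1. \<zeta> j \<in> polys_minus N M"
    and "f \<in> polys_plus N M"
    and "det (f 0) \<noteq> 0"
    and "F = block_laurent m M (\<lambda>i j.
               if i = m - 1 then (if j = m - 1 then f else \<zeta> j)
               else laurent_const (if i = j then 1\<^sub>m M else 0\<^sub>m M M))"
  shows "\<exists>(u :: nat \<Rightarrow> nat \<Rightarrow> laurent_mat) U.
           (\<forall>i<m. \<forall>j<m. u i j \<in> polys_plus N M) \<and>
           U = block_laurent m M (\<lambda>i j. if i = m - 1 then laurent_adj (u i j) else u i j) \<and>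
           para_unitary (m * M) U \<and>
           (\<forall>z. z \<noteq> 0 \<longrightarrow> det (laurent_eval (m * M) U z) = 1) \<and>
           (\<exists>G \<in> block_set m M (polys_plus N M). \<forall>z. z \<noteq> 0 \<longrightarrow>
              laurent_eval (m * M) F z * laurent_eval (m * M) U z = laurent_eval (m * M) G z)"
proof -
  define L where "L = (m - 1) * M"
  define K where "K = m * M"
  have K: "K = L + M"
    using \<open>m > 0\<close> by (cases m) (simp_all add: K_def L_def)
  have lower_less: "L + s < K" if "s < M" for s
    using that K by simp
  have last_div: "a div M = m - 1" if "L \<le> a" "a < K" for a
    using that \<open>M > 0\<close> \<open>m > 0\<close> by (cases m) (auto simp: K_def L_def mult.commute intro!: div_nat_eqI)
  have last_mod: "a mod M = a - L" if "L \<le> a" "a < K" for a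
    using last_div[OF that] by (metis L_def minus_div_mult_eq_mod)
  have upper_div: "a div M < m - 1" if "a < L" for a
    using block_index_less(1) that unfolding L_def .
  have mod_less: "a mod M < M" for a
    using \<open>M > 0\<close> by simp
  have div_mod: "a div M * M + a mod M = a" for a :: nat
    by simp
  have div_less: "a div M < m" if "a < K" for a
    using block_index_less(1) that unfolding K_def .

  have carr_f: "f n \<in> carrier_mat M M" and f_outside: "n < 0 \<or> int N < n \<Longrightarrow> f n = 0\<^sub>m M M" for n
    using assms(5) by (auto simp: polys_plus_def laurent_polys_def)
  have \<zeta>_outside: "n < - int N \<or> 0 < n \<Longrightarrow> \<zeta> j n = 0\<^sub>m M M" if "j < m - 1" for j n
    using assms(4) that by (auto simp: polys_minus_def laurent_polys_def)

  \<comment> \<open>The scalar entries of \<open>f\<close> and of the \<open>\<zeta>\<close> blocks, the latter in the variable \<open>1/z\<close>.\<close>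
  define fp where "fp r s = (\<Sum>k\<le>N. monom (f (int k) $$ (r, s)) k)" for r s
  define Z where "Z r b = (\<Sum>k\<le>N. monom (\<zeta> (b div M) (- int k) $$ (r, b mod M)) k)" for r b
  have deg_fp: "degree (fp r s) \<le> N" and deg_Z: "degree (Z r b) \<le> N" for r s b
    unfolding fp_def Z_def by (rule degree_sum_le; auto intro: degree_monom_le order_trans)+
  have coeff_fp: "f n $$ (r, s) = (if n \<ge> 0 then coeff (fp r s) (nat n) else 0)"
    if "r < M" "s < M" for r s n
  proof (cases "0 \<le> n \<and> n \<le> int N")
    case True
    then show ?thesis
      by (simp add: fp_def coeff_sum_monom nat_le_iff)
  next
    case False
    then have "f n = 0\<^sub>m M M"
      by (intro f_outside) linarith
    moreover have "coeff (fp r s) (nat n) = 0" if "n \<ge> 0"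
      using False that deg_fp[of r s] by (intro coeff_eq_0) linarith
    ultimately show ?thesis
      using that by simp
  qed
  have coeff_Z: "\<zeta> (b div M) n $$ (r, b mod M) = (if n \<le> 0 then coeff (Z r b) (nat (- n)) else 0)"
    if "r < M" "b < L" for r b n
  proof (cases "- int N \<le> n \<and> n \<le> 0")
    case True
    then show ?thesis
      by (simp add: Z_def coeff_sum_monom nat_le_iff)
  next
    case False
    then have "\<zeta> (b div M) n = 0\<^sub>m M M"
      by (intro \<zeta>_outside upper_div that) linarith
    moreover have "coeff (Z r b) (nat (- n)) = 0" if "n \<le> 0"
      using False that deg_Z[of r b] by (intro coeff_eq_0) linarith
    ultimately show ?thesis
      using that mod_less by simp
  qed
  have onto: "\<exists>c. \<forall>r<M. (\<Sum>s<M. poly (fp r s) 0 * c s) = h r" for h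
  proof -
    obtain B where B: "B \<in> carrier_mat M M" "f 0 * B = 1\<^sub>m M"
      using det_non_zero_imp_unit[OF carr_f assms(6)]
      by (auto simp: Units_def ring_mat_def)
    define v where "v = B *\<^sub>v vec M h"
    have v: "v \<in> carrier_vec M"
      using B(1) by (simp add: v_def)
    have "f 0 *\<^sub>v v = vec M h"
      unfolding v_def using B carr_f by (metis assoc_mult_mat_vec one_mult_mat_vec vec_carrier)
    moreover have "(f 0 *\<^sub>v v) $ r = (\<Sum>s<M. poly (fp r s) 0 * v $ s)" if "r < M" for r
      using that v carrier_matD[OF carr_f] coeff_fp[of r _ 0]
      by (simp add: scalar_prod_def atLeast0LessThan poly_0_coeff_0)
    ultimately show ?thesis
      by (intro exI[of _ "\<lambda>s. v $ s"]) auto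
  qed

  obtain P g where P: "\<And>a j. j < L + M \<Longrightarrow> degree (P j a) \<le> N"
    and orth: "\<And>i j z. i < L + M \<Longrightarrow> j < L + M \<Longrightarrow> z \<noteq> 0 \<Longrightarrow>
      (\<Sum>a<L + M. cnj (poly (P i a) (if a < L then 1 / cnj z else cnj z)) *
        poly (P j a) (if a < L then z else 1 / z)) = (if i = j then 1 else 0)"
    and det_1: "\<And>z. z \<noteq> 0 \<Longrightarrow>
      det (mat (L + M) (L + M) (\<lambda>(a, j). poly (P j a) (if a < L then z else 1 / z))) = 1"
    and g: "\<And>r j. r < M \<Longrightarrow> j < L + M \<Longrightarrow> degree (g r j) \<le> N"
    and FU: "\<And>r j z. r < M \<Longrightarrow> j < L + M \<Longrightarrow> z \<noteq> 0 \<Longrightarrow>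
      (\<Sum>b<L. poly (Z r b) (1 / z) * poly (P j b) z) +
      (\<Sum>s<M. poly (fp r s) z * poly (P j (L + s)) (1 / z)) = poly (g r j) z"
    by (rule entrywise_paraunitary_completion[OF deg_Z deg_fp onto \<open>M > 0\<close>]) (rule that)

  \<comment> \<open>The last block row of \<open>U\<close> consists of adjoints: there \<open>u\<close> carries the conjugated
    coefficients at transposed positions within the block.\<close>
  define u where "u i j = poly_block M (if i = m - 1
      then (\<lambda>r s. map_poly cnj (P (j * M + r) (i * M + s)))
      else (\<lambda>r s. P (j * M + s) (i * M + r)))" for i j
  define U where "U = block_laurent m M (\<lambda>i j. if i = m - 1 then laurent_adj (u i j) else u i j)"
  define g' where "g' a j = (if a < L then P j a else g (a - L) j)" for a j
  define H where "H i j = poly_block M (\<lambda>r s. g' (i * M + r) (j * M + s))" for i j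
  define G where "G = block_laurent m M H"

  have index_less: "j * M + s < K" if "j < m" "s < M" for j s
  proof -
    have "j * M + s < Suc j * M"
      using that by simp
    also have "\<dots> \<le> K"
      unfolding K_def using that by (intro mult_le_mono1) simp
    finally show ?thesis .
  qed
  have u: "u i j \<in> polys_plus N M" if "i < m" "j < m" for i j
    unfolding u_def using P index_less[OF that(2)] K
    by (intro poly_block_in_polys_plus) (auto intro: order_trans[OF degree_map_poly_le])
  have deg_g': "degree (g' a j) \<le> N" if "a < K" "j < K" for a j
    using that K P[of j a] g[of "a - L" j] by (auto simp: g'_def)
  have H: "H i j \<in> polys_plus N M" if "i < m" "j < m" for i j
    unfolding H_def by (intro poly_block_in_polys_plus deg_g' index_less that)

  have \<zeta>_laurent: "\<zeta> j \<in> laurent_polys N N M" if "j < m - 1" for j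
    using assms(4) that laurent_polys_mono[of "\<zeta> j" N 0 M N N] by (simp add: polys_minus_def)
  have f_laurent: "f \<in> laurent_polys N N M"
    using assms(5) laurent_polys_mono[of f 0 N M N N] by (simp add: polys_plus_def)
  have F_laurent: "F \<in> laurent_polys N N K"
    unfolding assms(7) K_def
    by (intro block_laurent_in_laurent_polys)
       (auto intro: \<zeta>_laurent f_laurent laurent_const_in_laurent_polys)
  have "u i j \<in> laurent_polys N N M" if "i < m" "j < m" for i j
    using u[OF that] laurent_polys_mono[of "u i j" 0 N M N N] by (simp add: polys_plus_def)
  then have U_laurent: "U \<in> laurent_polys N N K"
    unfolding U_def K_def
    by (intro block_laurent_in_laurent_polys) (auto intro: laurent_adj_in_laurent_polys)
  have G_laurent: "G \<in> laurent_polys 0 N K"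
    unfolding G_def K_def using H by (intro block_laurent_in_laurent_polys) (simp add: polys_plus_def)

  have F_upper: "laurent_eval K F z $$ (a, c) = (if a = c then 1 else 0)" if "a < L" "c < K" for a c z
  proof -
    have a: "a < K" "a div M \<noteq> m - 1"
      using that K upper_div[of a] by auto
    have eq: "a = c \<longleftrightarrow> a div M = c div M \<and> a mod M = c mod M"
      by (metis div_mod)
    have "laurent_eval K F z $$ (a, c) = poly [:if a = c then 1 else 0:] z"
      by (rule laurent_eval_entry_poly[OF F_laurent a(1) that(2)])
         (use a that eq mod_less in \<open>auto simp: assms(7) block_laurent_def laurent_const_def K_def[symmetric]
           coeff_pCons split: nat.splits\<close>)
    then show ?thesis
      by simp
  qed
  have F_lower_left: "laurent_eval K F z $$ (L + r, b) = poly (Z r b) (1 / z)" if "r < M" "b < L" for r b z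
  proof (rule laurent_eval_entry_poly_inverse[OF F_laurent])
    show "F n $$ (L + r, b) = (if n \<le> 0 then coeff (Z r b) (nat (- n)) else 0)" for n
      using that K last_div[of "L + r"] last_mod[of "L + r"] upper_div[of b] coeff_Z[OF that]
      by (simp add: assms(7) block_laurent_def K_def[symmetric])
  qed (use that K deg_Z in auto)
  have F_lower_right: "laurent_eval K F z $$ (L + r, L + s) = poly (fp r s) z" if "r < M" "s < M" for r s z
  proof (rule laurent_eval_entry_poly[OF F_laurent])
    show "F n $$ (L + r, L + s) = (if n \<ge> 0 then coeff (fp r s) (nat n) else 0)" for n
      using that K last_div[of "L + r"] last_mod[of "L + r"] last_div[of "L + s"] last_mod[of "L + s"]
        coeff_fp[OF that]
      by (simp add: assms(7) block_laurent_def K_def[symmetric])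
  qed (use that K deg_fp in auto)
  have U_upper: "laurent_eval K U z $$ (a, j) = poly (P j a) z" if "a < L" "j < K" for a j z
  proof (rule laurent_eval_entry_poly[OF U_laurent])
    show "U n $$ (a, j) = (if n \<ge> 0 then coeff (P j a) (nat n) else 0)" for n
      using that K upper_div[of a] mod_less
      by (simp add: U_def u_def block_laurent_def poly_block_def K_def[symmetric])
  qed (use that K P in auto)
  have U_lower: "laurent_eval K U z $$ (a, j) = poly (P j a) (1 / z)" if "L \<le> a" "a < K" "j < K" for a j z
  proof (rule laurent_eval_entry_poly_inverse[OF U_laurent])
    have "(m - 1) * M + a mod M = a"
      using div_mod[of a] last_div[OF that(1,2)] by simp
    then show "U n $$ (a, j) = (if n \<le> 0 then coeff (P j a) (nat (- n)) else 0)" for n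
      using that mod_less last_div[OF that(1,2)]
      by (simp add: U_def u_def block_laurent_def laurent_adj_def mat_adjoint_index poly_block_def
          coeff_map_poly K_def[symmetric])
  qed (use that K P in auto)
  have U_entry: "laurent_eval K U z $$ (a, j) = poly (P j a) (if a < L then z else 1 / z)"
    if "a < K" "j < K" for a j z
    using that U_upper U_lower by simp
  have G_entry: "laurent_eval K G z $$ (a, j) = poly (g' a j) z" if "a < K" "j < K" for a j z
  proof (rule laurent_eval_entry_poly[OF G_laurent])
    show "G n $$ (a, j) = (if n \<ge> 0 then coeff (g' a j) (nat n) else 0)" for n
      using that mod_less by (simp add: G_def H_def block_laurent_def poly_block_def K_def[symmetric])
  qed (use that deg_g' in auto)

  have adj_U: "laurent_eval K (laurent_adj U) z * laurent_eval K U z = 1\<^sub>m K" if "z \<noteq> 0" for z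
  proof (rule eq_matI)
    fix i j
    assume "i < dim_row (1\<^sub>m K :: complex mat)" "j < dim_col (1\<^sub>m K :: complex mat)"
    then have ij: "i < K" "j < K"
      by auto
    have "(laurent_eval K (laurent_adj U) z * laurent_eval K U z) $$ (i, j) =
        (\<Sum>a<K. laurent_eval K (laurent_adj U) z $$ (i, a) * laurent_eval K U z $$ (a, j))"
      using ij carrier_matD[OF laurent_eval_carrier] by (simp add: scalar_prod_def atLeast0LessThan)
    also have "\<dots> = (\<Sum>a<K. cnj (poly (P i a) (if a < L then 1 / cnj z else cnj z)) *
        poly (P j a) (if a < L then z else 1 / z))"
      using ij by (intro sum.cong refl) (auto simp: laurent_eval_adj[OF U_laurent] U_entry)
    also have "\<dots> = (if i = j then 1 else 0)"
      using orth[of i j z] ij that K by simp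
    finally show "(laurent_eval K (laurent_adj U) z * laurent_eval K U z) $$ (i, j) = 1\<^sub>m K $$ (i, j)"
      using ij by simp
  qed (use carrier_matD[OF laurent_eval_carrier] in auto)
  then have "para_unitary K U"
    unfolding para_unitary_def
    using U_laurent mat_mult_left_right_inverse[OF laurent_eval_carrier laurent_eval_carrier] by blast
  moreover have "det (laurent_eval K U z) = 1" if "z \<noteq> 0" for z
  proof -
    have "laurent_eval K U z = mat (L + M) (L + M) (\<lambda>(a, j). poly (P j a) (if a < L then z else 1 / z))"
      by (rule eq_matI) (use carrier_matD[OF laurent_eval_carrier] K U_entry in auto)
    then show ?thesis
      using det_1[OF that] by simp
  qed
  moreover have "laurent_eval K F z * laurent_eval K U z = laurent_eval K G z" if "z \<noteq> 0" for z
  proof (rule eq_matI)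
    fix a j
    assume "a < dim_row (laurent_eval K G z)" "j < dim_col (laurent_eval K G z)"
    then have aj: "a < K" "j < K"
      using carrier_matD[OF laurent_eval_carrier] by auto
    have prod: "(laurent_eval K F z * laurent_eval K U z) $$ (a, j) =
        (\<Sum>c<K. laurent_eval K F z $$ (a, c) * laurent_eval K U z $$ (c, j))"
      using aj carrier_matD[OF laurent_eval_carrier] by (simp add: scalar_prod_def atLeast0LessThan)
    show "(laurent_eval K F z * laurent_eval K U z) $$ (a, j) = laurent_eval K G z $$ (a, j)"
    proof (cases "a < L")
      case True
      have "(\<Sum>c<K. laurent_eval K F z $$ (a, c) * laurent_eval K U z $$ (c, j)) =
          (\<Sum>c<K. if a = c then laurent_eval K U z $$ (c, j) else 0)"
        using True by (intro sum.cong refl) (simp add: F_upper)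
      then show ?thesis
        using True aj by (simp add: prod U_upper G_entry g'_def)
    next
      case False
      define r where "r = a - L"
      have a: "a = L + r" "r < M"
        using False aj K by (auto simp: r_def)
      have "(\<Sum>c<K. laurent_eval K F z $$ (a, c) * laurent_eval K U z $$ (c, j)) =
          (\<Sum>b<L. laurent_eval K F z $$ (a, b) * laurent_eval K U z $$ (b, j)) +
          (\<Sum>s<M. laurent_eval K F z $$ (a, L + s) * laurent_eval K U z $$ (L + s, j))"
        unfolding K by (rule sum_lessThan_add)
      also have "\<dots> = (\<Sum>b<L. poly (Z r b) (1 / z) * poly (P j b) z) +
          (\<Sum>s<M. poly (fp r s) z * poly (P j (L + s)) (1 / z))"
        using a aj lower_less by (simp add: F_lower_left F_lower_right U_upper U_lower)
      also have "\<dots> = poly (g r j) z"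
        using a aj K that by (intro FU) auto
      finally show ?thesis
        unfolding prod using a aj by (simp add: G_entry g'_def)
    qed
  qed (use carrier_matD[OF laurent_eval_carrier] in auto)
  moreover have "G \<in> block_set m M (polys_plus N M)"
    unfolding block_set_def G_def using H by blast
  ultimately show ?thesis
    unfolding K_def using u U_def by blast
qed

end
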